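(* The nerve functor $N:\mathsf{Mag}^{\mathrm{ad}}\to\mathsf{Set}_\Delta$, $N(M,A)_n=\mathrm{Hom}_{\mathsf{Mag}^{\mathrm{ad}}}((\mathfrak D^n)^\sharp,(M,A))$, from partial unital magmas with associativity data to simplicial sets, is fully faithful, and its essential image consists of those simplicial sets which are spiny and reduced.
   Context: A partial unital magma $(M,\cdot,1)$ is a set $M$ with a partially defined binary operation $\cdot$ (pairs in its domain are called multiplicable) and an element $1\in M$ such that for every $m\in M$ the pairs $(m,1),(1,m)$ are multiplicable and $m\cdot 1=m=1\cdot m$. A morphism is a map of sets $f$ with $f(1)=1$ such that if $(m,n)$ is multiplicable then so is $(f(m),f(n))$ and $f(m\cdot n)=f(m)\cdot f(n)$. A binary bracketing of $n\ge2$ is an isomorphism class of planar binary rooted trees $T$ with $n$ leaves; it gives a partially defined operation $\cdot^T:M^{\times n}\to M$ by performing $\cdot$ at every vertex. A tuple in $M^{\times n}$ is multiplicable if it lies in the domain of $\cdot^T$ for every bracketing $T$ of $n$; it is associable if moreover all values of $\cdot^T$ agree; a multiplicable tuple $(b_1,\dots,b_n)$ is fully associable if each $(b_i,\dots,b_j)$, $1\le i<j\le n$, is associable. $F_n(M)$ is the set of fully associable $n$-tuples. An associativity datum on $M$ is a family of subsets $A_n\subset F_n(M)$, $n\ge2$ (with the convention $A_1=M$), such that: (1) $A_2$ is the domain of $\cdot$; (2) if $(b_1,\dots,b_n)\in A_n$ then for any $1\le i<n$, $(b_1,\dots,b_i)\in A_i$ and $(b_{i+1},\dots,b_n)\in A_{n-i}$;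 (3) if $(b_1,\dots,b_n)\in A_n$ then $(b_1,\dots,b_{i-1},1,b_i,\dots,b_n)\in A_{n+1}$ for any $1\le i\le n+1$. $\mathsf{Mag}^{\mathrm{ad}}$ is the category of partial unital magmas equipped with an associativity datum; its morphisms $(M,A^M)\to(L,A^L)$ are morphisms $f$ of partial unital magmas with $f^{\times n}(A^M_n)\subset A^L_n$ for all $n$. $M^\sharp$ denotes $M$ with the maximal datum $A_n=F_n(M)$. $\mathfrak D^n$ is the partial unital magma (indeed partial monoid) with non-identity elements $m_{i,j}$, $0\le i<j\le n$, and identity $1$, where the multiplicable pairs of non-identity elements are $(m_{i,j},m_{j,k})$ with $0\le i<j<k\le n$, and $m_{i,j}\cdot m_{j,k}=m_{i,k}$. A monotone map $\phi:[n]\to[k]$ induces $m_{i,j}\mapsto m_{\phi(i),\phi(j)}$, with the convention $m_{i,i}=1$; this makes $\mathfrak D^\bullet$ a cosimplicial object, and hence $N(M,A)$ a simplicial set. A simplicial set $X$ is reduced if $X_0$ is a singleton. It is spiny if for all $n\ge2$ the map $X_n\to X_1\times_{X_0}\cdots\times_{X_0}X_1$ ($n$ factors) given by restriction to the spine of $\Delta^n$ (the edges $\{i,i+1\}$) is injective.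
   Formalization: Fullness fails as stated; here it is claimed only when the source object's associativity datum is closed under multiplying adjacent entries ((..,x,y,..) in A_n gives (..,xy,..) in A_{n-1}); every spiny reduced simplicial set is shown to be the nerve of such an object. *)

theory Defs
  imports Main "HOL-Library.FuncSet"
begin

section \<open>Partial unital magmas\<close>

text \<open>The domain of the operation is the set of pairs on which \<open>pmult\<close> is not \<open>None\<close>.\<close>

record 'a pumag =
  carr :: "'a set"
  unt :: 'a
  pmult :: "'a \<Rightarrow> 'a \<Rightarrow> 'a option"

definition partial_unital_magma :: "('a, 'z) pumag_scheme \<Rightarrow> bool" where
  "partial_unital_magma M \<longleftrightarrow>
     unt M \<in> carr M \<and>
     (\<forall>x y z. pmult M x y = Some z \<longrightarrow> x \<in> carr M \<and> y \<in> carr M \<and> z \<in> carr M) \<and>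
     (\<forall>m\<in>carr M. pmult M m (unt M) = Some m \<and> pmult M (unt M) m = Some m)"

text \<open>Morphisms are functions that are \<open>undefined\<close> off the carrier, so that equality of
  morphisms is equality in HOL.\<close>

definition pumag_hom :: "('a, 'y) pumag_scheme \<Rightarrow> ('b, 'z) pumag_scheme \<Rightarrow> ('a \<Rightarrow> 'b) set" where
  "pumag_hom M L = {f \<in> carr M \<rightarrow>\<^sub>E carr L.
     f (unt M) = unt L \<and>
     (\<forall>x y z. pmult M x y = Some z \<longrightarrow> pmult L (f x) (f y) = Some (f z))}"

section \<open>Bracketings and associability\<close>

datatype bracketing = Leaf | Node bracketing bracketing

fun leaves :: "bracketing \<Rightarrow> nat" where
  "leaves Leaf = 1"
| "leaves (Node S T) = leaves S + leaves T"

text \<open>\<open>n\<close>-tuples are lists of length \<open>n\<close>; \<open>bracket_val M T\<close> is the partial operation \<open>\<cdot>\<^sup>T\<close>,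
  with value \<open>None\<close> outside its domain.\<close>

fun bracket_val :: "('a, 'z) pumag_scheme \<Rightarrow> bracketing \<Rightarrow> 'a list \<Rightarrow> 'a option" where
  "bracket_val M Leaf bs = (case bs of [b] \<Rightarrow> Some b | _ \<Rightarrow> None)"
| "bracket_val M (Node S T) bs =
     (case bracket_val M S (take (leaves S) bs) of
        None \<Rightarrow> None
      | Some x \<Rightarrow> (case bracket_val M T (drop (leaves S) bs) of
                    None \<Rightarrow> None
                  | Some y \<Rightarrow> pmult M x y))"

definition multiplicable :: "('a, 'z) pumag_scheme \<Rightarrow> 'a list \<Rightarrow> bool" where
  "multiplicable M bs \<longleftrightarrow>
     set bs \<subseteq> carr M \<and> (\<forall>T. leaves T = length bs \<longrightarrow> bracket_val M T bs \<noteq> None)"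

definition associable :: "('a, 'z) pumag_scheme \<Rightarrow> 'a list \<Rightarrow> bool" where
  "associable M bs \<longleftrightarrow> multiplicable M bs \<and>
     (\<forall>S T. leaves S = length bs \<and> leaves T = length bs \<longrightarrow>
        bracket_val M S bs = bracket_val M T bs)"

text \<open>With \<open>0\<close>-based positions, \<open>take (Suc j - i) (drop i bs)\<close> is the subtuple from position
  \<open>i\<close> to position \<open>j\<close>, both included.\<close>

definition fully_associable :: "('a, 'z) pumag_scheme \<Rightarrow> 'a list \<Rightarrow> bool" where
  "fully_associable M bs \<longleftrightarrow> multiplicable M bs \<and>
     (\<forall>i j. i < j \<and> j < length bs \<longrightarrow> associable M (take (Suc j - i) (drop i bs)))"

definition fully_assoc_tuples :: "('a, 'z) pumag_scheme \<Rightarrow> nat \<Rightarrow> 'a list set" where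
  "fully_assoc_tuples M n = {bs. length bs = n \<and> fully_associable M bs}"

section \<open>Associativity data\<close>

record 'a magad = "'a pumag" +
  datum :: "nat \<Rightarrow> 'a list set"

text \<open>The datum proper is the family of the \<open>A n\<close> with \<open>n \<ge> 2\<close>; the values at \<open>0\<close> and \<open>1\<close> are
  fixed by convention.\<close>

definition associativity_datum ::
  "('a, 'z) pumag_scheme \<Rightarrow> (nat \<Rightarrow> 'a list set) \<Rightarrow> bool" where
  "associativity_datum M A \<longleftrightarrow>
     A 0 = {} \<and> A 1 = {[m] | m. m \<in> carr M} \<and>
     (\<forall>n\<ge>2. A n \<subseteq> fully_assoc_tuples M n) \<and>
     A 2 = {[x, y] | x y. pmult M x y \<noteq> None} \<and>
     (\<forall>n\<ge>2. \<forall>bs\<in>A n. \<forall>i. 1 \<le> i \<and> i < n \<longrightarrow> take i bs \<in> A i \<and> drop i bs \<in> A (n - i)) \<and>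
     (\<forall>n\<ge>2. \<forall>bs\<in>A n. \<forall>i\<le>n. take i bs @ [unt M] @ drop i bs \<in> A (n + 1))"

definition mag_ad :: "'a magad \<Rightarrow> bool" where
  "mag_ad M \<longleftrightarrow> partial_unital_magma M \<and> associativity_datum M (datum M)"

definition magad_hom :: "'a magad \<Rightarrow> 'b magad \<Rightarrow> ('a \<Rightarrow> 'b) set" where
  "magad_hom M L = {f \<in> pumag_hom M L. \<forall>n. \<forall>bs\<in>datum M n. map f bs \<in> datum L n}"

text \<open>Closure of a datum under multiplying two neighbouring entries. The conditions defining an
  associativity datum do not imply it, and without it \<open>N\<close> is not full. Take the commutative
  monoid \<open>M = {1, b, c}\<close> in which all products of non-identity elements are \<open>c\<close>. Let \<open>A\<close>
  consist of the tuples that become, after deleting all entries \<open>1\<close>, a tuple of length at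
  most \<open>2\<close> or one of \<open>(b,b,b)\<close>, \<open>(b,b,b,b)\<close>; let \<open>A'\<close> be \<open>A\<close> without the tuples reducing to
  \<open>(b,b,b,b)\<close>. Both are associativity data. If \<open>f\<close> is an \<open>n\<close>-simplex of the nerve of \<open>(M, A)\<close> and
  \<open>t\<close> is a fully associable tuple of \<open>\<DD>\<^sup>n\<close> with \<open>f t\<close> reducing to \<open>(b,b,b,b)\<close>, then multiplying
  up an initial segment of \<open>t\<close> gives a fully associable tuple whose image reduces to
  \<open>(c,b,b)\<close>, which is not in \<open>A\<close>. So \<open>(M, A)\<close> and \<open>(M, A')\<close> have the same nerve, and the identity of
  this nerve is not induced by a morphism from \<open>(M, A)\<close> to \<open>(M, A')\<close>.\<close>

definition mult_closed_datum :: "'a magad \<Rightarrow> bool" where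
  "mult_closed_datum M \<longleftrightarrow>
     (\<forall>bs x y cs z. bs @ [x, y] @ cs \<in> datum M (length bs + 2 + length cs) \<longrightarrow>
        pmult M x y = Some z \<longrightarrow> bs @ [z] @ cs \<in> datum M (length bs + 1 + length cs))"

definition magad_id :: "'a magad \<Rightarrow> 'a \<Rightarrow> 'a" where
  "magad_id M = (\<lambda>x\<in>carr M. x)"

definition magad_comp :: "'a magad \<Rightarrow> ('b \<Rightarrow> 'c) \<Rightarrow> ('a \<Rightarrow> 'b) \<Rightarrow> 'a \<Rightarrow> 'c" where
  "magad_comp M g f = compose (carr M) g f"

text \<open>\<open>M\<^sup>\<sharp>\<close>, with the convention above in degrees \<open>0\<close> and \<open>1\<close>.\<close>

definition sharp :: "'a pumag \<Rightarrow> 'a magad" where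
  "sharp M = \<lparr>carr = carr M, unt = unt M, pmult = pmult M,
     datum = (\<lambda>n. if n = 0 then {} else if n = 1 then {[m] | m. m \<in> carr M}
                  else fully_assoc_tuples M n)\<rparr>"

section \<open>Simplicial sets\<close>

text \<open>Monotone maps \<open>[n] \<rightarrow> [k]\<close>, with \<open>[n] = {0, \<dots>, n}\<close>.\<close>

definition delta_hom :: "nat \<Rightarrow> nat \<Rightarrow> (nat \<Rightarrow> nat) set" where
  "delta_hom n k = {\<phi> \<in> {..n} \<rightarrow>\<^sub>E {..k}. mono_on {..n} \<phi>}"

text \<open>\<open>act X n k \<phi> : X\<^sub>k \<rightarrow> X\<^sub>n\<close> is the map induced by \<open>\<phi> : [n] \<rightarrow> [k]\<close>.\<close>

record 'b sset =
  simp :: "nat \<Rightarrow> 'b set"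
  act :: "nat \<Rightarrow> nat \<Rightarrow> (nat \<Rightarrow> nat) \<Rightarrow> 'b \<Rightarrow> 'b"

definition simplicial_set :: "'b sset \<Rightarrow> bool" where
  "simplicial_set X \<longleftrightarrow>
     (\<forall>n k. \<forall>\<phi>\<in>delta_hom n k. act X n k \<phi> \<in> simp X k \<rightarrow> simp X n) \<and>
     (\<forall>n. \<forall>x\<in>simp X n. act X n n (\<lambda>i\<in>{..n}. i) x = x) \<and>
     (\<forall>n k l. \<forall>\<phi>\<in>delta_hom n k. \<forall>\<psi>\<in>delta_hom k l. \<forall>x\<in>simp X l.
        act X n l (compose {..n} \<psi> \<phi>) x = act X n k \<phi> (act X k l \<psi> x))"

definition sset_hom :: "'b sset \<Rightarrow> 'c sset \<Rightarrow> (nat \<Rightarrow> 'b \<Rightarrow> 'c) set" where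
  "sset_hom X Y = {F. (\<forall>n. F n \<in> simp X n \<rightarrow>\<^sub>E simp Y n) \<and>
     (\<forall>n k. \<forall>\<phi>\<in>delta_hom n k. \<forall>x\<in>simp X k. F n (act X n k \<phi> x) = act Y n k \<phi> (F k x))}"

definition sset_id :: "'b sset \<Rightarrow> nat \<Rightarrow> 'b \<Rightarrow> 'b" where
  "sset_id X = (\<lambda>n. \<lambda>x\<in>simp X n. x)"

definition sset_comp ::
  "'b sset \<Rightarrow> (nat \<Rightarrow> 'c \<Rightarrow> 'd) \<Rightarrow> (nat \<Rightarrow> 'b \<Rightarrow> 'c) \<Rightarrow> nat \<Rightarrow> 'b \<Rightarrow> 'd" where
  "sset_comp X G F = (\<lambda>n. compose (simp X n) (G n) (F n))"

definition sset_isomorphic :: "'b sset \<Rightarrow> 'c sset \<Rightarrow> bool" where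
  "sset_isomorphic X Y \<longleftrightarrow> (\<exists>F\<in>sset_hom X Y. \<exists>G\<in>sset_hom Y X.
     sset_comp X G F = sset_id X \<and> sset_comp Y F G = sset_id Y)"

definition reduced :: "'b sset \<Rightarrow> bool" where
  "reduced X \<longleftrightarrow> is_singleton (simp X 0)"

definition spine_edge :: "nat \<Rightarrow> nat \<Rightarrow> nat" where
  "spine_edge i = (\<lambda>j\<in>{..1}. i + j)"

text \<open>Injectivity of the map into the fibre product is injectivity of the list of its \<open>n\<close>
  components in \<open>X\<^sub>1\<close>.\<close>

definition spiny :: "'b sset \<Rightarrow> bool" where
  "spiny X \<longleftrightarrow>
     (\<forall>n\<ge>2. inj_on (\<lambda>x. map (\<lambda>i. act X 1 n (spine_edge i) x) [0..<n]) (simp X n))"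

section \<open>The nerve\<close>

text \<open>\<open>DM i j\<close> is \<open>m\<^sub>i\<^sub>,\<^sub>j\<close>; \<open>delem\<close> implements the convention \<open>m\<^sub>i\<^sub>,\<^sub>i = 1\<close>.\<close>

datatype delem = DOne | DM nat nat

definition delem :: "nat \<Rightarrow> nat \<Rightarrow> delem" where
  "delem i j = (if i = j then DOne else DM i j)"

definition dmag_carr :: "nat \<Rightarrow> delem set" where
  "dmag_carr n = {DOne} \<union> {DM i j | i j. i < j \<and> j \<le> n}"

fun dmag_mult :: "nat \<Rightarrow> delem \<Rightarrow> delem \<Rightarrow> delem option" where
  "dmag_mult n DOne x = (if x \<in> dmag_carr n then Some x else None)"
| "dmag_mult n x DOne = (if x \<in> dmag_carr n then Some x else None)"
| "dmag_mult n (DM i j) (DM j' k) =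
     (if j = j' \<and> i < j \<and> j < k \<and> k \<le> n then Some (DM i k) else None)"

definition dmag :: "nat \<Rightarrow> delem pumag" where
  "dmag n = \<lparr>carr = dmag_carr n, unt = DOne, pmult = dmag_mult n\<rparr>"

text \<open>The map \<open>\<DD>\<^sup>n \<rightarrow> \<DD>\<^sup>k\<close> induced by \<open>\<phi> : [n] \<rightarrow> [k]\<close>.\<close>

definition dmag_map :: "nat \<Rightarrow> (nat \<Rightarrow> nat) \<Rightarrow> delem \<Rightarrow> delem" where
  "dmag_map n \<phi> = (\<lambda>x\<in>dmag_carr n. case x of DOne \<Rightarrow> DOne | DM i j \<Rightarrow> delem (\<phi> i) (\<phi> j))"

definition nerve :: "'a magad \<Rightarrow> (delem \<Rightarrow> 'a) sset" where
  "nerve M = \<lparr>simp = (\<lambda>n. magad_hom (sharp (dmag n)) M),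
     act = (\<lambda>n k \<phi> \<sigma>. compose (dmag_carr n) \<sigma> (dmag_map n \<phi>))\<rparr>"

definition nerve_map :: "'a magad \<Rightarrow> ('a \<Rightarrow> 'b) \<Rightarrow> nat \<Rightarrow> (delem \<Rightarrow> 'a) \<Rightarrow> (delem \<Rightarrow> 'b)" where
  "nerve_map M f = (\<lambda>n. \<lambda>\<sigma>\<in>simp (nerve M) n. compose (dmag_carr n) f \<sigma>)"

end

theory Submission
  imports Defs
begin

text \<open>The fully associable tuples of \<open>\<DD>\<^sup>n\<close> are exactly the spines
  \<open>(m\<^bsub>\<psi> 0,\<psi> 1\<^esub>, m\<^bsub>\<psi> 1,\<psi> 2\<^esub>, \<dots>)\<close> of monotone maps \<open>\<psi> : [k] \<rightarrow> [n]\<close>. So an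
  \<open>n\<close>-simplex of the nerve is a coherent family of elements \<open>e i j\<close> with \<open>e i j \<cdot> e j k = e i k\<close>
  all of whose spines along such \<open>\<psi>\<close> lie in the datum. Edges of the nerve of \<open>M\<close> are elements of
  \<open>M\<close>, which gives faithfulness. For fullness, a tuple in the datum yields the simplex of its
  partial products, using that the datum is closed under multiplying neighbours, and a simplicial
  map is then determined by its effect on edges. Conversely, a spiny reduced \<open>X\<close> is the nerve of
  the magma whose elements are the edges of \<open>X\<close>, whose products are witnessed by \<open>2\<close>-simplices and
  whose datum consists of the spines of simplices.\<close>

section \<open>Coherent families\<close>

text \<open>For a partial unital magma \<open>M\<close>, such a family encodes a morphism out of
  \<open>dmag n\<close>, with \<open>e i j\<close> the image of \<open>delem i j\<close>. The weak
  inequalities treat units and proper \<open>DM i j\<close> alike; values with \<open>i > j\<close>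
  are left free.\<close>

definition coherent :: "('a, 'z) pumag_scheme \<Rightarrow> nat \<Rightarrow> (nat \<Rightarrow> nat \<Rightarrow> 'a) \<Rightarrow> bool" where
  "coherent M n e \<longleftrightarrow> (\<forall>i\<le>n. e i i = unt M) \<and>
     (\<forall>i j k. i \<le> j \<longrightarrow> j \<le> k \<longrightarrow> k \<le> n \<longrightarrow> pmult M (e i j) (e j k) = Some (e i k))"

lemma coherentD:
  assumes "coherent M n e"
  shows "i \<le> n \<Longrightarrow> e i i = unt M"
    and "i \<le> j \<Longrightarrow> j \<le> k \<Longrightarrow> k \<le> n \<Longrightarrow> pmult M (e i j) (e j k) = Some (e i k)"
  using assms by (simp_all add: coherent_def)

definition chain :: "(nat \<Rightarrow> nat \<Rightarrow> 'a) \<Rightarrow> nat \<Rightarrow> 'a list" where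
  "chain e n = map (\<lambda>i. e i (Suc i)) [0..<n]"

lemma length_chain [simp]: "length (chain e n) = n"
  by (simp add: chain_def)

lemma nth_chain [simp]: "i < n \<Longrightarrow> chain e n ! i = e i (Suc i)"
  by (simp add: chain_def)

lemma map_chain: "map f (chain e n) = chain (\<lambda>i j. f (e i j)) n"
  by (simp add: chain_def)

lemma chain_cong:
  assumes "\<And>i. i < n \<Longrightarrow> e i (Suc i) = e' i (Suc i)"
  shows "chain e n = chain e' n"
  using assms by (simp add: chain_def)

text \<open>The product of \<open>e i i\<close> and \<open>e i j\<close> is defined, and
  \<open>pmult\<close> is defined only on the carrier.\<close>

lemma coherent_carr:
  assumes "partial_unital_magma M" "coherent M n e" "i \<le> j" "j \<le> n"
  shows "e i j \<in> carr M"
  using assms unfolding coherent_def partial_unital_magma_def by (metis le_refl)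

lemma coherent_reindex:
  assumes "coherent M n e" "mono_on {..k} \<psi>" "\<psi> ` {..k} \<subseteq> {..n}"
  shows "coherent M k (\<lambda>i j. e (\<psi> i) (\<psi> j))"
  using assms unfolding coherent_def mono_on_def image_subset_iff by auto

lemma coherent_cong:
  assumes "\<And>i j. i \<le> j \<Longrightarrow> j \<le> n \<Longrightarrow> e i j = e' i j"
  shows "coherent M n e \<longleftrightarrow> coherent M n e'"
  using assms by (auto simp: coherent_def)

text \<open>Induction on \<open>j\<close>: \<open>e i (Suc m)\<close> is the product of
  \<open>e i m\<close> and the spine entry \<open>e m (Suc m)\<close>. This is the source of the
  spininess of nerves.\<close>

lemma coherent_eqI:
  assumes "coherent M n e" "coherent M n e'"
    and "\<And>i. i < n \<Longrightarrow> e i (Suc i) = e' i (Suc i)" "i \<le> j" "j \<le> n"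
  shows "e i j = e' i j"
  using \<open>i \<le> j\<close> \<open>j \<le> n\<close>
proof (induction j rule: dec_induct)
  case base
  then show ?case using assms(1,2) by (simp add: coherent_def)
next
  case (step m)
  from step.hyps step.prems have "pmult M (e i m) (e m (Suc m)) = Some (e i (Suc m))"
    "pmult M (e' i m) (e' m (Suc m)) = Some (e' i (Suc m))"
    using assms(1,2) unfolding coherent_def by simp_all
  then show ?case using step assms(3)[of m] by simp
qed

section \<open>Bracketed products along the spine of a coherent family\<close>

fun comb :: "nat \<Rightarrow> bracketing" where
  "comb 0 = Leaf"
| "comb (Suc n) = Node (comb n) Leaf"

lemma leaves_comb [simp]: "leaves (comb n) = Suc n"
  by (induction n) auto

lemma leaves_pos: "0 < leaves T"
  by (induction T) auto

text \<open>Each vertex of the tree multiplies some \<open>e a b\<close> by \<open>e b c\<close>, so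
  the product telescopes and the value does not depend on the shape of \<open>T\<close>.\<close>

lemma bracket_val_coherent:
  assumes "coherent M n e" "a + leaves T \<le> n"
  shows "bracket_val M T (map (\<lambda>i. e i (Suc i)) [a..<a + leaves T]) = Some (e a (a + leaves T))"
  using assms(2)
proof (induction T arbitrary: a)
  case (Node S T)
  have "bracket_val M S (map (\<lambda>i. e i (Suc i)) [a..<a + leaves S]) = Some (e a (a + leaves S))"
    "bracket_val M T (map (\<lambda>i. e i (Suc i)) [a + leaves S..<a + leaves S + leaves T])
       = Some (e (a + leaves S) (a + leaves S + leaves T))"
    using Node by simp_all
  moreover have "pmult M (e a (a + leaves S)) (e (a + leaves S) (a + leaves S + leaves T))
      = Some (e a (a + leaves S + leaves T))"
    using assms(1) Node.prems unfolding coherent_def by simp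
  ultimately show ?case
    by (simp add: take_map drop_map add.assoc)
qed simp

lemma coherent_associable:
  assumes "partial_unital_magma M" "coherent M n e" "a < b" "b \<le> n"
  shows "associable M (map (\<lambda>i. e i (Suc i)) [a..<b])"
proof -
  have "bracket_val M T (map (\<lambda>i. e i (Suc i)) [a..<b]) = Some (e a b)" if "leaves T = b - a" for T
    using bracket_val_coherent[OF assms(2), of a T] assms(3,4) that by simp
  moreover have "set (map (\<lambda>i. e i (Suc i)) [a..<b]) \<subseteq> carr M"
    using coherent_carr[OF assms(1,2)] assms(4) by auto
  ultimately show ?thesis
    by (simp add: associable_def multiplicable_def)
qed

lemma coherent_fully_associable:
  assumes "partial_unital_magma M" "coherent M n e" "0 < n"
  shows "fully_associable M (chain e n)"
proof -
  \<comment> \<open>Every subtuple of a chain is a segment of it, to which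
    \<open>coherent_associable\<close> applies. The whole tuple is handled as the segment from
    \<open>0\<close> to \<open>n\<close>, which for \<open>n = 1\<close> is not among the subtuples
    with \<open>i < j\<close>.\<close>
  have "take (Suc j - i) (drop i (chain e n)) = map (\<lambda>i. e i (Suc i)) [i..<Suc j]"
    if "i < j" "j < n" for i j
    using that by (simp add: chain_def take_map drop_map del: upt_Suc)
  then show ?thesis
    using coherent_associable[OF assms(1,2)] coherent_associable[OF assms(1,2,3)]
    unfolding fully_associable_def chain_def[of e n, symmetric]
    by (simp add: associable_def[of M "chain e n"] del: upt_Suc)
qed

section \<open>The magmas \<open>\<DD>\<^sup>n\<close>\<close>

lemma dmag_sel [simp]: "carr (dmag n) = dmag_carr n" "unt (dmag n) = DOne" "pmult (dmag n) = dmag_mult n"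
  by (simp_all add: dmag_def)

lemma sharp_sel [simp]: "carr (sharp M) = carr M" "unt (sharp M) = unt M" "pmult (sharp M) = pmult M"
  by (simp_all add: sharp_def)

lemma delem_in_carr [simp]: "i \<le> j \<Longrightarrow> j \<le> n \<Longrightarrow> delem i j \<in> dmag_carr n"
  by (auto simp: dmag_carr_def delem_def)

lemma delem_refl [simp]: "delem i i = DOne"
  by (simp add: delem_def)

lemma dmag_carrE:
  assumes "x \<in> dmag_carr n"
  obtains i j where "i \<le> j" "j \<le> n" "x = delem i j"
proof (cases x)
  case DOne
  then show ?thesis using that[of 0 0] by simp
next
  case (DM i j)
  then show ?thesis using assms that[of i j] by (auto simp: dmag_carr_def delem_def)
qed

lemma coherent_delem: "coherent (dmag n) n delem"
  by (auto simp: coherent_def delem_def dmag_carr_def)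

text \<open>Products with the unit are the degenerate cases \<open>i = j\<close> or
  \<open>j = k\<close> of \<open>delem i j\<close> times \<open>delem j k\<close>, so one family of
  equations describes the whole multiplication.\<close>

lemma dmag_multE:
  assumes "dmag_mult n x y = Some z"
  obtains i j k where "i \<le> j" "j \<le> k" "k \<le> n" "x = delem i j" "y = delem j k" "z = delem i k"
proof (cases x)
  case DOne
  with assms have y: "y \<in> dmag_carr n" "z = y" by (auto split: if_splits)
  then obtain i j where "i \<le> j" "j \<le> n" "y = delem i j" by (elim dmag_carrE)
  then show ?thesis using that[of i i j] y DOne by simp
next
  case x: (DM i j)
  show ?thesis
  proof (cases y)
    case DOne
    with assms x have "x \<in> dmag_carr n" "z = x" by (auto split: if_splits)
    moreover from this obtain i j where "i \<le> j" "j \<le> n" "x = delem i j" by (elim dmag_carrE)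
    ultimately show ?thesis using that[of i j j] DOne by simp
  next
    case (DM j' k)
    then show ?thesis using assms x that[of i j k] by (auto simp: delem_def split: if_splits)
  qed
qed

lemma partial_unital_magma_dmag: "partial_unital_magma (dmag n)"
proof -
  have "x \<in> dmag_carr n \<and> y \<in> dmag_carr n \<and> z \<in> dmag_carr n" if "dmag_mult n x y = Some z" for x y z
    using that by (elim dmag_multE) simp
  moreover have "dmag_mult n m DOne = Some m \<and> dmag_mult n DOne m = Some m" if "m \<in> dmag_carr n" for m
    using that by (cases m) auto
  ultimately show ?thesis
    by (auto simp: partial_unital_magma_def dmag_carr_def)
qed

section \<open>Multiplicable tuples in \<open>dmag n\<close>\<close>

lemma multiplicable_snoc:
  assumes "multiplicable M (bs @ [x])" "leaves T = length bs"
  obtains v w where "bracket_val M T bs = Some v" "pmult M v x = Some w"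
  using assms unfolding multiplicable_def
  by (auto dest!: spec[where x = "Node T Leaf"] split: option.splits)

lemma multiplicable_butlast:
  assumes "multiplicable M (bs @ [x])"
  shows "multiplicable M bs"
proof -
  have "bracket_val M T bs \<noteq> None" if "leaves T = length bs" for T
    using multiplicable_snoc[OF assms that] by fastforce
  then show ?thesis using assms by (simp add: multiplicable_def)
qed

text \<open>Entries are appended one at a time. The product of the prefix must be multiplicable with
  the new entry, so the endpoint reached so far is the starting point of the new entry, unless one
  of the two is the unit, which fits at every vertex.\<close>

lemma multiplicable_dmag_chain:
  assumes "multiplicable (dmag n) bs" "bs \<noteq> []"
  shows "\<exists>\<psi>. mono_on {..length bs} \<psi> \<and> \<psi> ` {..length bs} \<subseteq> {..n} \<and>
           bs = chain (\<lambda>i j. delem (\<psi> i) (\<psi> j)) (length bs)"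
  using assms
proof (induction bs rule: rev_induct)
  case (snoc x bs)
  have x: "x \<in> dmag_carr n" using snoc.prems by (simp add: multiplicable_def)
  then obtain i j where ij: "i \<le> j" "j \<le> n" "x = delem i j" by (elim dmag_carrE)
  show ?case
  proof (cases "bs = []")
    case True
    have "mono_on {..Suc 0} (\<lambda>t. if t = 0 then i else j)" using ij by (auto simp: mono_on_def)
    then show ?thesis using True ij
      by (intro exI[of _ "\<lambda>t. if t = 0 then i else j"]) (auto simp: chain_def)
  next
    case False
    define k where "k = length bs"
    have k: "0 < k" using False by (simp add: k_def)
    from snoc.IH[OF multiplicable_butlast[OF snoc.prems(1)] False] obtain \<psi>
      where \<psi>: "mono_on {..k} \<psi>" "\<psi> ` {..k} \<subseteq> {..n}" "bs = chain (\<lambda>i j. delem (\<psi> i) (\<psi> j)) k"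
      unfolding k_def by blast
    \<comment> \<open>\<open>\<theta>\<close> may differ from the \<open>\<psi>\<close> of the
      induction hypothesis, because a prefix made of units is a chain over any vertex.\<close>
    have snoc_chain: ?thesis
      if "mono_on {..k} \<theta>" "\<theta> ` {..k} \<subseteq> {..n}" "bs = chain (\<lambda>i j. delem (\<theta> i) (\<theta> j)) k"
        "\<theta> k \<le> c" "c \<le> n" "x = delem (\<theta> k) c" for \<theta> c
    proof (intro exI[of _ "\<theta>(Suc k := c)"] conjI)
      have "\<theta> s \<le> c" if "s \<le> k" for s
        using \<open>mono_on {..k} \<theta>\<close> \<open>\<theta> k \<le> c\<close> that unfolding mono_on_def by (meson atMost_iff le_trans order_refl)
      then show "mono_on {..length (bs @ [x])} (\<theta>(Suc k := c))"
        using that(1) by (auto simp: mono_on_def k_def[symmetric] le_Suc_eq)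
      show "(\<theta>(Suc k := c)) ` {..length (bs @ [x])} \<subseteq> {..n}"
        using that(2,5) by (auto simp: k_def[symmetric] le_Suc_eq image_subset_iff)
      have "bs = chain (\<lambda>i j. delem ((\<theta>(Suc k := c)) i) ((\<theta>(Suc k := c)) j)) k"
        by (subst that(3)) (rule chain_cong, simp)
      then show "bs @ [x] = chain (\<lambda>i j. delem ((\<theta>(Suc k := c)) i) ((\<theta>(Suc k := c)) j)) (length (bs @ [x]))"
        using that(6) by (simp add: k_def[symmetric] chain_def)
    qed
    have coh: "coherent (dmag n) k (\<lambda>i j. delem (\<psi> i) (\<psi> j))"
      by (rule coherent_reindex[OF coherent_delem \<psi>(1,2)])
    \<comment> \<open>\<open>comb (k - 1)\<close> has \<open>k\<close> leaves; by coherence it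
      evaluates the prefix to its long edge.\<close>
    have "bracket_val (dmag n) (comb (k - 1)) bs = Some (delem (\<psi> 0) (\<psi> k))"
      using bracket_val_coherent[OF coh, of 0 "comb (k - 1)"] k \<psi>(3) by (simp add: chain_def)
    moreover have "leaves (comb (k - 1)) = length bs" using k by (simp add: k_def)
    ultimately obtain w where w: "dmag_mult n (delem (\<psi> 0) (\<psi> k)) x = Some w"
      using multiplicable_snoc[OF snoc.prems(1), of "comb (k - 1)" thesis] by auto
    have le: "\<psi> 0 \<le> \<psi> s \<and> \<psi> s \<le> \<psi> k" if "s \<le> k" for s
      using \<psi>(1) that by (simp add: mono_on_def)
    have \<psi>k: "\<psi> k \<le> n" using \<psi>(2) by auto
    consider "x = DOne" | "i < j" "\<psi> 0 = \<psi> k" | "i < j" "\<psi> 0 < \<psi> k"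
      using ij le[of k] by (force simp: delem_def)
    then show ?thesis
    proof cases
      case 1
      then show ?thesis using snoc_chain[OF \<psi>, of "\<psi> k"] \<psi>k by simp
    next
      case 2
      \<comment> \<open>Here \<open>\<psi>\<close> is constant and \<open>bs\<close> consists of
        units; the constant map at \<open>i\<close> replaces \<open>\<psi>\<close> so that it can be
        continued to \<open>j\<close>.\<close>
      have "\<psi> s = \<psi> (Suc s)" if "s < k" for s using le[of s] le[of "Suc s"] that 2 by simp
      then have "bs = chain (\<lambda>a b. delem i i) k" by (subst \<psi>(3)) (simp add: chain_def)
      then show ?thesis
        using snoc_chain[of "\<lambda>_. i" j] ij 2 by (simp add: mono_on_def image_subset_iff)
    next
      case 3
      \<comment> \<open>The prefix has the non-unit product \<open>DM (\<psi> 0) (\<psi> k)\<close>,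
        and its product with \<open>DM i j\<close> is defined only if the inner indices
        agree.\<close>
      with w ij have "\<psi> k = i" by (auto simp: delem_def split: if_splits)
      then show ?thesis using snoc_chain[OF \<psi>, of j] ij by simp
    qed
  qed
qed simp

lemma delta_hom_mono: "\<phi> \<in> delta_hom n k \<Longrightarrow> i \<le> j \<Longrightarrow> j \<le> n \<Longrightarrow> \<phi> i \<le> \<phi> j"
  by (auto simp: delta_hom_def mono_on_def)

lemma delta_hom_le: "\<phi> \<in> delta_hom n k \<Longrightarrow> i \<le> n \<Longrightarrow> \<phi> i \<le> k"
  by (auto simp: delta_hom_def PiE_def)

lemma delta_homI:
  assumes "\<And>i j. i \<le> j \<Longrightarrow> j \<le> n \<Longrightarrow> \<phi> i \<le> \<phi> j" "\<phi> n \<le> k"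
  shows "(\<lambda>i\<in>{..n}. \<phi> i) \<in> delta_hom n k"
  using assms by (auto simp: delta_hom_def mono_on_def PiE_def intro: order_trans)

lemma delta_hom_compose:
  "\<phi> \<in> delta_hom n k \<Longrightarrow> \<psi> \<in> delta_hom k l \<Longrightarrow> compose {..n} \<psi> \<phi> \<in> delta_hom n l"
  unfolding compose_def
  by (rule delta_homI) (auto intro: delta_hom_mono delta_hom_le)

text \<open>One inclusion is \<open>multiplicable_dmag_chain\<close>; for the other, a chain along
  \<open>\<psi>\<close> comes from reindexing the tautological coherent family \<open>delem\<close>.
  In degree \<open>0\<close> the datum is empty by convention.\<close>

lemma datum_sharp_dmag:
  assumes "0 < k"
  shows "datum (sharp (dmag n)) k = (\<lambda>\<psi>. chain (\<lambda>i j. delem (\<psi> i) (\<psi> j)) k) ` delta_hom k n"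
proof (rule set_eqI, rule iffI)
  fix bs assume bs: "bs \<in> datum (sharp (dmag n)) k"
  have len: "length bs = k" "multiplicable (dmag n) bs"
  proof -
    show "length bs = k" using bs assms by (auto simp: sharp_def fully_assoc_tuples_def split: if_splits)
    show "multiplicable (dmag n) bs"
    \<comment> \<open>In degree \<open>1\<close> the datum is the carrier by convention, so
      multiplicability is read off from the only bracketing with one leaf.\<close>
    proof (cases "k = 1")
      case True
      then obtain m where m: "m \<in> dmag_carr n" "bs = [m]" using bs by (auto simp: sharp_def)
      have "T = Leaf" if "leaves T = 1" for T
          using that leaves_pos by (cases T) (auto simp: add_is_1 less_not_refl2)
      with m show ?thesis by (force simp: multiplicable_def)
    next
      case False
      then show ?thesis using bs assms by (auto simp: sharp_def fully_assoc_tuples_def fully_associable_def)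
    qed
  qed
  then have "bs \<noteq> []" using assms by auto
  then obtain \<psi> where \<psi>: "mono_on {..k} \<psi>" "\<psi> ` {..k} \<subseteq> {..n}" "bs = chain (\<lambda>i j. delem (\<psi> i) (\<psi> j)) k"
    using multiplicable_dmag_chain len by blast
  have "restrict \<psi> {..k} \<in> delta_hom k n"
    using \<psi>(1,2) by (intro delta_homI) (auto simp: mono_on_def)
  moreover have "bs = chain (\<lambda>i j. delem (restrict \<psi> {..k} i) (restrict \<psi> {..k} j)) k"
    by (subst \<psi>(3)) (rule chain_cong, simp)
  ultimately show "bs \<in> (\<lambda>\<psi>. chain (\<lambda>i j. delem (\<psi> i) (\<psi> j)) k) ` delta_hom k n" by blast
next
  fix bs assume "bs \<in> (\<lambda>\<psi>. chain (\<lambda>i j. delem (\<psi> i) (\<psi> j)) k) ` delta_hom k n"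
  then obtain \<psi> where \<psi>: "\<psi> \<in> delta_hom k n" "bs = chain (\<lambda>i j. delem (\<psi> i) (\<psi> j)) k" by blast
  then have coh: "coherent (dmag n) k (\<lambda>i j. delem (\<psi> i) (\<psi> j))"
    by (intro coherent_reindex[OF coherent_delem]) (auto simp: delta_hom_def PiE_def)
  show "bs \<in> datum (sharp (dmag n)) k"
  proof (cases "k = 1")
    case True
    then show ?thesis using coherent_carr[OF partial_unital_magma_dmag coh, of 0 1] \<psi>
      by (auto simp: sharp_def chain_def)
  next
    case False
    then show ?thesis
      using coherent_fully_associable[OF partial_unital_magma_dmag coh assms] assms \<psi>
      by (simp add: sharp_def fully_assoc_tuples_def)
  qed
qed

section \<open>Simplices of the nerve\<close>

text \<open>Turns the hom-set into conditions on a family: \<open>dmag_multE\<close> lists the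
  products of \<open>dmag n\<close>, and \<open>datum_sharp_dmag\<close> its fully associable
  tuples. Later arguments about the nerve rest on this description.\<close>

lemma simp_nerve_iff:
  assumes "partial_unital_magma M"
  shows "\<sigma> \<in> simp (nerve M) n \<longleftrightarrow> \<sigma> \<in> extensional (dmag_carr n) \<and>
    coherent M n (\<lambda>i j. \<sigma> (delem i j)) \<and>
    (\<forall>k>0. \<forall>\<psi>\<in>delta_hom k n. chain (\<lambda>i j. \<sigma> (delem (\<psi> i) (\<psi> j))) k \<in> datum M k)"
    (is "_ \<longleftrightarrow> ?E \<and> ?C \<and> ?D")
proof -
  have D: "(\<forall>k. \<forall>bs\<in>datum (sharp (dmag n)) k. map \<sigma> bs \<in> datum M k) \<longleftrightarrow> ?D"
  proof -
    \<comment> \<open>Degree \<open>0\<close> contributes no tuples, which leaves the degrees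
      covered by \<open>datum_sharp_dmag\<close>.\<close>
    have "datum (sharp (dmag n)) 0 = {}" by (simp add: sharp_def)
    then have "(\<forall>k. \<forall>bs\<in>datum (sharp (dmag n)) k. map \<sigma> bs \<in> datum M k) \<longleftrightarrow>
      (\<forall>k>0. \<forall>bs\<in>datum (sharp (dmag n)) k. map \<sigma> bs \<in> datum M k)"
      by (metis empty_iff gr0I)
    also have "\<dots> \<longleftrightarrow> ?D" by (simp add: datum_sharp_dmag map_chain)
    finally show ?thesis .
  qed
  have "\<sigma> \<in> pumag_hom (sharp (dmag n)) M \<longleftrightarrow> ?E \<and> ?C"
  proof
    assume h: "\<sigma> \<in> pumag_hom (sharp (dmag n)) M"
    then show "?E \<and> ?C"
      using coherent_delem[of n] by (auto simp: pumag_hom_def PiE_def coherent_def)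
  next
    assume h: "?E \<and> ?C"
    have "\<sigma> DOne = unt M" using h by (auto simp: coherent_def)
    moreover have "\<sigma> \<in> dmag_carr n \<rightarrow> carr M"
      using coherent_carr[OF assms] h by (auto elim!: dmag_carrE)
    moreover have "pmult M (\<sigma> x) (\<sigma> y) = Some (\<sigma> z)" if "dmag_mult n x y = Some z" for x y z
      using that h by (elim dmag_multE) (auto simp: coherent_def)
    ultimately show "\<sigma> \<in> pumag_hom (sharp (dmag n)) M"
      using h by (auto simp: pumag_hom_def PiE_def)
  qed
  then show ?thesis using D by (auto simp: nerve_def magad_hom_def)
qed

lemma ext_delemI:
  assumes "\<sigma> \<in> extensional (dmag_carr n)" "\<tau> \<in> extensional (dmag_carr n)"
    and "\<And>i j. i \<le> j \<Longrightarrow> j \<le> n \<Longrightarrow> \<sigma> (delem i j) = \<tau> (delem i j)"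
  shows "\<sigma> = \<tau>"
  using assms by (intro extensionalityI[of _ "dmag_carr n"]) (auto elim!: dmag_carrE)

lemma act_nerve_ext: "act (nerve M) n k \<phi> \<sigma> \<in> extensional (dmag_carr n)"
  by (simp add: nerve_def)

lemma act_nerve_delem [simp]:
  assumes "\<phi> \<in> delta_hom n k" "i \<le> j" "j \<le> n"
  shows "act (nerve M) n k \<phi> \<sigma> (delem i j) = \<sigma> (delem (\<phi> i) (\<phi> j))"
  using assms by (simp add: nerve_def compose_eq dmag_map_def) (simp add: delem_def)

text \<open>A coherent family is determined by its spine. For \<open>n = 0\<close> the condition on
  spines is void, so the nerve has at most one vertex.\<close>

lemma nerve_simplex_eqI:
  assumes "partial_unital_magma M" "\<sigma> \<in> simp (nerve M) n" "\<tau> \<in> simp (nerve M) n"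
    and "\<And>i. i < n \<Longrightarrow> \<sigma> (delem i (Suc i)) = \<tau> (delem i (Suc i))"
  shows "\<sigma> = \<tau>"
  using assms(2,3) unfolding simp_nerve_iff[OF assms(1)]
  using coherent_eqI[where e = "\<lambda>i j. \<sigma> (delem i j)" and e' = "\<lambda>i j. \<tau> (delem i j)", of M n]
    assms(4) by (intro ext_delemI[of \<sigma> n]) auto

lemma simplicial_set_nerve:
  assumes "partial_unital_magma M"
  shows "simplicial_set (nerve M)"
  unfolding simplicial_set_def
proof (intro conjI allI ballI funcsetI)
  fix n k \<phi> \<sigma> assume \<phi>: "\<phi> \<in> delta_hom n k" and \<sigma>: "\<sigma> \<in> simp (nerve M) k"
  let ?\<tau> = "act (nerve M) n k \<phi> \<sigma>"
  note \<sigma>' = \<sigma>[unfolded simp_nerve_iff[OF assms]]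
  have "coherent M n (\<lambda>i j. \<sigma> (delem (\<phi> i) (\<phi> j)))"
    using coherent_reindex[where e = "\<lambda>i j. \<sigma> (delem i j)" and \<psi> = \<phi> and k = n] \<sigma>' \<phi>
    by (auto simp: delta_hom_def PiE_def)
  then have "coherent M n (\<lambda>i j. ?\<tau> (delem i j))"
    by (subst coherent_cong) (rule act_nerve_delem[OF \<phi>])
  moreover have "chain (\<lambda>i j. ?\<tau> (delem (\<psi> i) (\<psi> j))) l \<in> datum M l"
    if "0 < l" "\<psi> \<in> delta_hom l n" for l \<psi>
  proof -
    \<comment> \<open>The datum condition on \<open>\<sigma>\<close> ranges over all monotone maps
      into \<open>{..k}\<close>, so it applies to the composite of \<open>\<psi>\<close> with
      \<open>\<phi>\<close>.\<close>
    have "chain (\<lambda>i j. ?\<tau> (delem (\<psi> i) (\<psi> j))) l =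
        chain (\<lambda>i j. \<sigma> (delem (compose {..l} \<phi> \<psi> i) (compose {..l} \<phi> \<psi> j))) l"
      using that \<phi> by (intro chain_cong) (simp add: compose_eq delta_hom_mono delta_hom_le)
    then show ?thesis using \<sigma>' that delta_hom_compose[OF that(2) \<phi>] by metis
  qed
  ultimately show "?\<tau> \<in> simp (nerve M) n"
    unfolding simp_nerve_iff[OF assms] using act_nerve_ext by blast
next
  fix n \<sigma> assume \<sigma>: "\<sigma> \<in> simp (nerve M) n"
  have "(\<lambda>i\<in>{..n}. i) \<in> delta_hom n n" by (rule delta_homI) auto
  then show "act (nerve M) n n (\<lambda>i\<in>{..n}. i) \<sigma> = \<sigma>"
    using \<sigma> unfolding simp_nerve_iff[OF assms]
    by (intro ext_delemI[OF act_nerve_ext]) auto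
next
  fix n k l \<phi> \<psi> \<sigma>
  assume "\<phi> \<in> delta_hom n k" "\<psi> \<in> delta_hom k l" "\<sigma> \<in> simp (nerve M) l"
  then show "act (nerve M) n l (compose {..n} \<psi> \<phi>) \<sigma> = act (nerve M) n k \<phi> (act (nerve M) k l \<psi> \<sigma>)"
    by (intro ext_delemI[OF act_nerve_ext act_nerve_ext])
      (simp add: delta_hom_compose delta_hom_mono delta_hom_le compose_eq)
qed

section \<open>Associativity data\<close>

lemma mag_ad_pum: "mag_ad M \<Longrightarrow> partial_unital_magma M"
  by (simp add: mag_ad_def)

lemma datum_Nil: "mag_ad M \<Longrightarrow> bs \<in> datum M (length bs) \<Longrightarrow> bs \<noteq> []"
  by (auto simp: mag_ad_def associativity_datum_def)

lemma datum_single: "mag_ad M \<Longrightarrow> [m] \<in> datum M (Suc 0) \<longleftrightarrow> m \<in> carr M"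
  by (simp add: mag_ad_def associativity_datum_def)

lemma datum_pair: "mag_ad M \<Longrightarrow> [x, y] \<in> datum M 2 \<longleftrightarrow> pmult M x y \<noteq> None"
  by (simp add: mag_ad_def associativity_datum_def)

lemma datum_fully_associable:
  assumes "mag_ad M" "bs \<in> datum M n" "2 \<le> n"
  shows "length bs = n \<and> fully_associable M bs"
proof -
  have "\<forall>n\<ge>2. datum M n \<subseteq> fully_assoc_tuples M n"
    using assms(1) by (simp add: mag_ad_def associativity_datum_def)
  then have "bs \<in> fully_assoc_tuples M n" using assms(2,3) by blast
  then show ?thesis by (simp add: fully_assoc_tuples_def)
qed

lemma datum_length: "mag_ad M \<Longrightarrow> bs \<in> datum M n \<Longrightarrow> length bs = n"
proof -
  assume h: "mag_ad M" "bs \<in> datum M n"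
  consider "n = 0" | "n = 1" | "2 \<le> n" by linarith
  then show ?thesis using h datum_fully_associable[OF h]
    by cases (auto simp: mag_ad_def associativity_datum_def)
qed

lemma datum_append:
  assumes "mag_ad M" "xs @ ys \<in> datum M (length (xs @ ys))" "xs \<noteq> []" "ys \<noteq> []"
  shows "xs \<in> datum M (length xs)" "ys \<in> datum M (length ys)"
proof -
  have l: "2 \<le> length (xs @ ys)" "1 \<le> length xs" "length xs < length (xs @ ys)"
    using assms(3,4) by (cases xs; cases ys; simp)+
  have "\<forall>n\<ge>2. \<forall>bs\<in>datum M n. \<forall>i. 1 \<le> i \<and> i < n \<longrightarrow> take i bs \<in> datum M i \<and> drop i bs \<in> datum M (n - i)"
    using assms(1) by (simp add: mag_ad_def associativity_datum_def)
  then have "take (length xs) (xs @ ys) \<in> datum M (length xs)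
      \<and> drop (length xs) (xs @ ys) \<in> datum M (length (xs @ ys) - length xs)"
    using assms(2) l by blast
  then show "xs \<in> datum M (length xs)" "ys \<in> datum M (length ys)" by simp_all
qed

text \<open>Axiom (3) starts at degree \<open>2\<close>. In degree \<open>1\<close> the claim holds
  because an element and the unit are multiplicable in either order, and the datum in degree
  \<open>2\<close> is the domain of the product.\<close>

lemma datum_insert_unt:
  assumes "mag_ad M" "xs @ ys \<in> datum M (length (xs @ ys))"
  shows "xs @ unt M # ys \<in> datum M (Suc (length (xs @ ys)))"
proof (cases "2 \<le> length (xs @ ys)")
  case True
  have "\<forall>n\<ge>2. \<forall>bs\<in>datum M n. \<forall>i\<le>n. take i bs @ [unt M] @ drop i bs \<in> datum M (n + 1)"
    using assms(1) by (simp add: mag_ad_def associativity_datum_def)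
  moreover have "length xs \<le> length (xs @ ys)" by simp
  ultimately have "take (length xs) (xs @ ys) @ [unt M] @ drop (length xs) (xs @ ys)
      \<in> datum M (length (xs @ ys) + 1)"
    using True assms(2) by blast
  then show ?thesis by simp
next
  case False
  moreover have "length (xs @ ys) \<noteq> 0" using datum_Nil[OF assms] by simp
  ultimately have l: "length (xs @ ys) = 1" by linarith
  then obtain m where m: "xs @ ys = [m]" by (metis One_nat_def length_0_conv length_Suc_conv)
  then have "m \<in> carr M" using assms datum_single[OF assms(1)] by simp
  then have "[m, unt M] \<in> datum M 2" "[unt M, m] \<in> datum M 2"
    using datum_pair[OF assms(1)] mag_ad_pum[OF assms(1)] by (simp_all add: partial_unital_magma_def)
  then show ?thesis using m by (auto simp: append_eq_Cons_conv numeral_2_eq_2)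
qed

section \<open>Products of consecutive entries of a tuple in a datum\<close>

definition block_product :: "'a magad \<Rightarrow> 'a list \<Rightarrow> nat \<Rightarrow> nat \<Rightarrow> 'a" where
  "block_product M bs i j =
     (if i = j then unt M else the (bracket_val M (comb (j - Suc i)) (map ((!) bs) [i..<j])))"

lemma map_nth_upt_append: "i \<le> j \<Longrightarrow> j \<le> k \<Longrightarrow> map f [i..<j] @ map f [j..<k] = map f [i..<k]"
  by (metis le_Suc_ex map_append upt_add_eq_append)

text \<open>Full associability makes all bracketings of a segment agree, so the choice of
  \<open>comb\<close> in \<open>block_product\<close> is harmless and \<open>the\<close> is applied
  to a defined value. A segment of length \<open>1\<close> has only the bracketing
  \<open>Leaf\<close>.\<close>

lemma bracket_val_block:
  assumes M: "mag_ad M" and bs: "bs \<in> datum M n" and ij: "i < j" "j \<le> n" and T: "leaves T = j - i"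
  shows "bracket_val M T (map ((!) bs) [i..<j]) = Some (block_product M bs i j)"
proof -
  have len: "length bs = n" using datum_length[OF M bs] .
  show ?thesis
  proof (cases "j = Suc i")
    case True
    then have "T = Leaf" using T leaves_pos by (cases T) (auto simp: add_is_1 less_not_refl2)
    then show ?thesis using True by (simp add: block_product_def)
  next
    case False
    then have n: "2 \<le> n" using ij by simp
    \<comment> \<open>Subtuples in \<open>fully_associable\<close> include both end positions, so
      the half-open segment \<open>[i..<j]\<close> ends at \<open>j - 1\<close>.\<close>
    then have "associable M (take (Suc (j - 1) - i) (drop i bs))"
    proof -
      have "i < j - 1" "j - 1 < length bs" using False ij len by simp_all
      then show ?thesis
        using datum_fully_associable[OF M bs n] unfolding fully_associable_def by blast
    qed
    moreover have "take (Suc (j - 1) - i) (drop i bs) = map ((!) bs) [i..<j]"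
      using ij len by (intro nth_equalityI) auto
    ultimately have a: "associable M (map ((!) bs) [i..<j])" by simp
    have "leaves (comb (j - Suc i)) = j - i" using ij by simp
    with a T have "bracket_val M T (map ((!) bs) [i..<j])
        = bracket_val M (comb (j - Suc i)) (map ((!) bs) [i..<j])"
      "bracket_val M T (map ((!) bs) [i..<j]) \<noteq> None"
      unfolding associable_def multiplicable_def length_map length_upt by blast+
    then show ?thesis using ij by (auto simp: block_product_def)
  qed
qed

lemma block_product_Suc: "block_product M bs i (Suc i) = bs ! i"
  by (simp add: block_product_def)

text \<open>Grafting bracketings of two adjacent segments gives a bracketing of their union, whose
  value is the block product of the union by \<open>bracket_val_block\<close>.\<close>

lemma coherent_block_product:
  assumes M: "mag_ad M" and bs: "bs \<in> datum M n" "0 < n"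
  shows "coherent M n (block_product M bs)"
proof -
  have c: "block_product M bs i j \<in> carr M" if "i < j" "j \<le> n" for i j
  proof (cases "j = Suc i")
    case True
    have "set bs \<subseteq> carr M"
    proof (cases "n = 1")
      case True
      then show ?thesis using M bs datum_single by (auto simp: mag_ad_def associativity_datum_def)
    next
      case False
      then show ?thesis using datum_fully_associable[OF M bs(1)] bs(2)
        by (simp add: fully_associable_def multiplicable_def)
    qed
    then show ?thesis using datum_length[OF M bs(1)] that True
      by (auto simp: block_product_Suc)
  next
    case False
    \<comment> \<open>A bracketing with a \<open>Node\<close> at the root is chosen, since its value
      is then a result of \<open>pmult\<close> and lies in the carrier.\<close>
    have "leaves (Node Leaf (comb (j - Suc (Suc i)))) = j - i" using that False by simp
    from bracket_val_block[OF M bs(1) that this] show ?thesis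
      using mag_ad_pum[OF M] by (auto simp: partial_unital_magma_def split: option.splits)
  qed
  have u: "pmult M (unt M) m = Some m" "pmult M m (unt M) = Some m" if "m \<in> carr M" for m
    using that mag_ad_pum[OF M] by (simp_all add: partial_unital_magma_def)
  have r: "block_product M bs i i = unt M" for i by (simp add: block_product_def)
  have uc: "unt M \<in> carr M" using mag_ad_pum[OF M] by (simp add: partial_unital_magma_def)
  have "pmult M (block_product M bs i j) (block_product M bs j k) = Some (block_product M bs i k)"
    if ijk: "i \<le> j" "j \<le> k" "k \<le> n" for i j k
  proof -
    consider "i = j" "j = k" | "i = j" "j < k" | "i < j" "j = k" | "i < j" "j < k" using ijk by linarith
    then show ?thesis
    proof cases
      case 4
      have l: "leaves (Node (comb (j - Suc i)) (comb (k - Suc j))) = k - i" using 4 by simp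
      have s: "take (j - i) (map ((!) bs) [i..<k]) = map ((!) bs) [i..<j]"
        "drop (j - i) (map ((!) bs) [i..<k]) = map ((!) bs) [j..<k]"
        using 4 by (simp_all add: take_map drop_map)
      have "bracket_val M (comb (j - Suc i)) (map ((!) bs) [i..<j]) = Some (block_product M bs i j)"
        "bracket_val M (comb (k - Suc j)) (map ((!) bs) [j..<k]) = Some (block_product M bs j k)"
        using 4 ijk by (intro bracket_val_block[OF M bs(1)]; simp)+
      moreover have "Suc (j - Suc i) = j - i" using 4 by simp
      ultimately show ?thesis
        using bracket_val_block[OF M bs(1) _ _ l] 4 ijk s by simp
    qed (use u c ijk r uc in simp_all)
  qed
  then show ?thesis by (simp add: coherent_def r)
qed

text \<open>Induction on the tree: the left and the right part of \<open>ys\<close> are contracted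
  in turn, each with the rest of the tuple as context, and closure of the datum then multiplies the
  two remaining neighbours.\<close>

lemma datum_contract:
  assumes "mult_closed_datum M"
    and "bracket_val M T ys = Some v" "xs @ ys @ zs \<in> datum M (length (xs @ ys @ zs))"
  shows "xs @ v # zs \<in> datum M (length (xs @ v # zs))"
  using assms(2,3)
proof (induction T arbitrary: xs ys zs v)
  case Leaf
  then show ?case by (auto split: list.splits)
next
  case (Node S T)
  then obtain x y where x: "bracket_val M S (take (leaves S) ys) = Some x"
    and y: "bracket_val M T (drop (leaves S) ys) = Some y" and xy: "pmult M x y = Some v"
    by (auto split: option.splits)
  have "xs @ take (leaves S) ys @ drop (leaves S) ys @ zs
      \<in> datum M (length (xs @ take (leaves S) ys @ drop (leaves S) ys @ zs))"
    using Node.prems(2) by (metis append.assoc append_take_drop_id)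
  from Node.IH(1)[OF x this]
  have "(xs @ [x]) @ drop (leaves S) ys @ zs \<in> datum M (length ((xs @ [x]) @ drop (leaves S) ys @ zs))"
    by simp
  from Node.IH(2)[OF y this] have "xs @ [x, y] @ zs \<in> datum M (length xs + 2 + length zs)" by simp
  then show ?case using assms(1) xy unfolding mult_closed_datum_def by force
qed

section \<open>Simplices of the nerve with a given spine\<close>

definition simplex_of :: "nat \<Rightarrow> (nat \<Rightarrow> nat \<Rightarrow> 'a) \<Rightarrow> delem \<Rightarrow> 'a" where
  "simplex_of n e = (\<lambda>x\<in>dmag_carr n. case x of DOne \<Rightarrow> e 0 0 | DM i j \<Rightarrow> e i j)"

lemma simplex_of_ext: "simplex_of n e \<in> extensional (dmag_carr n)"
  by (simp add: simplex_of_def)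

lemma simplex_of_delem:
  assumes "coherent M n e" "i \<le> j" "j \<le> n"
  shows "simplex_of n e (delem i j) = e i j"
proof (cases "i = j")
  case True
  \<comment> \<open>On \<open>DOne\<close> the simplex takes the value \<open>e 0 0\<close>, which
    coherence identifies with every \<open>e i i\<close>.\<close>
  then have "e i j = e 0 0" using assms by (simp add: coherent_def)
  then show ?thesis using True by (simp add: simplex_of_def dmag_carr_def)
next
  case False
  then show ?thesis using assms delem_in_carr[of i j n] by (simp add: simplex_of_def delem_def)
qed

lemma simplex_of_in_nerve:
  assumes "partial_unital_magma M" "coherent M n e"
    and "\<And>k \<psi>. 0 < k \<Longrightarrow> \<psi> \<in> delta_hom k n \<Longrightarrow> chain (\<lambda>i j. e (\<psi> i) (\<psi> j)) k \<in> datum M k"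
  shows "simplex_of n e \<in> simp (nerve M) n"
  unfolding simp_nerve_iff[OF assms(1)]
proof (intro conjI allI impI ballI simplex_of_ext)
  show "coherent M n (\<lambda>i j. simplex_of n e (delem i j))"
    by (subst coherent_cong) (auto simp: simplex_of_delem[OF assms(2)] assms(2))
  fix k \<psi> assume k: "0 < k" "\<psi> \<in> delta_hom k n"
  have "chain (\<lambda>i j. simplex_of n e (delem (\<psi> i) (\<psi> j))) k = chain (\<lambda>i j. e (\<psi> i) (\<psi> j)) k"
    using k by (intro chain_cong simplex_of_delem[OF assms(2)]) (auto intro: delta_hom_mono delta_hom_le)
  then show "chain (\<lambda>i j. simplex_of n e (delem (\<psi> i) (\<psi> j))) k \<in> datum M k"
    using assms(3)[OF k] by simp
qed

text \<open>For \<open>n = 1\<close> there is nothing to contract, so that elements of an arbitrary object give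
  edges of its nerve.\<close>

lemma chain_block_product:
  assumes M: "mag_ad M" and bs: "bs \<in> datum M n" "0 < n" and mc: "mult_closed_datum M \<or> n = 1"
    and k: "0 < k" and \<psi>: "\<psi> \<in> delta_hom k n"
  shows "chain (\<lambda>i j. block_product M bs (\<psi> i) (\<psi> j)) k \<in> datum M k"
proof -
  let ?e = "block_product M bs"
  have contract: "xs @ ?e i j # zs \<in> datum M (length (xs @ ?e i j # zs))"
    if "i < j" "j \<le> n" "xs @ map ((!) bs) [i..<j] @ zs \<in> datum M (length (xs @ map ((!) bs) [i..<j] @ zs))"
    for i j xs zs
  proof (cases "n = 1")
    case True
    then have "i = 0" "j = 1" using that by auto
    then show ?thesis using that(3) by (simp add: block_product_def)
  next
    case False
    have "leaves (comb (j - Suc i)) = j - i" using that by simp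
    note b = bracket_val_block[OF M bs(1) that(1,2) this]
    show ?thesis using datum_contract[OF _ b that(3)] False mc by simp
  qed
  \<comment> \<open>An empty block contributes the unit, which may be inserted anywhere.\<close>
  have step: "xs @ ?e i j # zs \<in> datum M (length (xs @ ?e i j # zs))"
    if "i \<le> j" "j \<le> n" "xs @ map ((!) bs) [i..<j] @ zs \<in> datum M (length (xs @ map ((!) bs) [i..<j] @ zs))"
    for i j xs zs
  proof (cases "i = j")
    case True
    then show ?thesis using datum_insert_unt[OF M, of xs zs] that(3) by (simp add: block_product_def)
  qed (use contract that in simp)
  have slice: "map ((!) bs) [i..<j] \<in> datum M (j - i)" if "i < j" "j \<le> n" for i j
  proof -
    have len: "length bs = n" using datum_length[OF M bs(1)] .
    have "map ((!) bs) [0..<n] \<in> datum M n" using bs(1) len map_nth[of bs] by simp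
    then have "map ((!) bs) [0..<j] @ map ((!) bs) [j..<n] \<in> datum M n"
      using that by (simp add: map_nth_upt_append)
    then have "map ((!) bs) [0..<j] \<in> datum M j"
      using datum_append(1)[OF M, of "map ((!) bs) [0..<j]" "map ((!) bs) [j..<n]"] that
      by (cases "j = n") auto
    then have "map ((!) bs) [0..<i] @ map ((!) bs) [i..<j] \<in> datum M j"
      using that by (simp add: map_nth_upt_append)
    then show ?thesis
      using datum_append(2)[OF M, of "map ((!) bs) [0..<i]" "map ((!) bs) [i..<j]"] that
      by (cases "i = 0") auto
  qed
  \<comment> \<open>\<open>L i\<close> has its first \<open>i\<close> blocks multiplied up and the
    rest still as entries of \<open>bs\<close>. It interpolates between a segment of
    \<open>bs\<close> at \<open>i = 0\<close> and the wanted chain at \<open>i = k\<close>.\<close>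
  define L where "L i = chain (\<lambda>i j. ?e (\<psi> i) (\<psi> j)) i @ map ((!) bs) [\<psi> i..<\<psi> k]" for i
  have mono: "\<psi> i \<le> \<psi> j" if "i \<le> j" "j \<le> k" for i j using delta_hom_mono[OF \<psi> that] .
  have le: "\<psi> i \<le> n" if "i \<le> k" for i using delta_hom_le[OF \<psi> that] .
  have L_Suc: "L (Suc i) \<in> datum M (length (L (Suc i)))"
    if "L i \<in> datum M (length (L i))" "i < k" for i
  proof -
    have "map ((!) bs) [\<psi> i..<\<psi> k] = map ((!) bs) [\<psi> i..<\<psi> (Suc i)] @ map ((!) bs) [\<psi> (Suc i)..<\<psi> k]"
      using mono that by (simp add: map_nth_upt_append)
    then show ?thesis
      using step[OF mono[of i "Suc i"] le, of "chain (\<lambda>i j. ?e (\<psi> i) (\<psi> j)) i"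
          "map ((!) bs) [\<psi> (Suc i)..<\<psi> k]"] that
      by (simp add: L_def chain_def)
  qed
  \<comment> \<open>The induction starts at \<open>1\<close>: if \<open>\<psi>\<close> is constant,
    \<open>L 0\<close> is empty and lies in no datum, whereas \<open>L 1\<close> is the one-element
    tuple of the unit.\<close>
  have "L i \<in> datum M (length (L i))" if "1 \<le> i" "i \<le> k" for i
    using that
  proof (induction i rule: dec_induct)
    case base
    show ?case
    proof (cases "\<psi> 0 < \<psi> k")
      case True
      then have "L 0 \<in> datum M (length (L 0))"
        using slice[OF True le] by (simp add: L_def chain_def)
      then show ?thesis using L_Suc[of 0] k by simp
    next
      case False
      then have "\<psi> 0 = \<psi> 1" "\<psi> 1 = \<psi> k" using mono[of 0 1] mono[of 1 k] k by simp_all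
      then show ?thesis
        using datum_single[OF M] mag_ad_pum[OF M]
        by (simp add: L_def chain_def block_product_def partial_unital_magma_def)
    qed
  next
    case (step i)
    then show ?case using L_Suc[of i] by simp
  qed
  from this[of k] show ?thesis using k by (simp add: L_def)
qed

definition spine_simplex :: "'a magad \<Rightarrow> 'a list \<Rightarrow> delem \<Rightarrow> 'a" where
  "spine_simplex M bs = simplex_of (length bs) (block_product M bs)"

lemma spine_simplex:
  assumes M: "mag_ad M" and bs: "bs \<in> datum M n" "0 < n" and mc: "mult_closed_datum M \<or> n = 1"
  shows "spine_simplex M bs \<in> simp (nerve M) n"
    and "i < n \<Longrightarrow> spine_simplex M bs (delem i (Suc i)) = bs ! i"
  using simplex_of_in_nerve[OF mag_ad_pum[OF M] coherent_block_product[OF M bs] chain_block_product[OF assms]]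
    simplex_of_delem[OF coherent_block_product[OF M bs], of i "Suc i"] datum_length[OF M bs(1)]
  by (simp_all add: spine_simplex_def block_product_Suc)

lemma edge_simplex:
  assumes "mag_ad M" "m \<in> carr M"
  shows "spine_simplex M [m] \<in> simp (nerve M) 1" "spine_simplex M [m] (delem 0 1) = m"
  using spine_simplex[OF assms(1), of "[m]" 1] assms datum_single[OF assms(1), of m] by auto

section \<open>Functoriality, faithfulness and fullness\<close>

text \<open>For \<open>i = j\<close> this is the degenerate edge at a vertex, so units can be
  treated as edges too.\<close>

definition edge_map :: "nat \<Rightarrow> nat \<Rightarrow> nat \<Rightarrow> nat" where
  "edge_map i j = (\<lambda>t\<in>{..1}. if t = 0 then i else j)"

lemma edge_map_simps [simp]: "edge_map i j 0 = i" "edge_map i j (Suc 0) = j"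
  by (simp_all add: edge_map_def)

lemma edge_map_delta: "i \<le> j \<Longrightarrow> j \<le> n \<Longrightarrow> edge_map i j \<in> delta_hom 1 n"
  unfolding edge_map_def by (rule delta_homI) auto

lemma spine_edge_eq: "spine_edge i = edge_map i (Suc i)"
  by (auto simp: spine_edge_def edge_map_def fun_eq_iff)

lemma edge_map_id: "edge_map 0 1 = (\<lambda>i\<in>{..1}. i)"
  by (auto simp: edge_map_def fun_eq_iff)

lemma compose_edge_map: "compose {..1} \<phi> (edge_map i j) = edge_map (\<phi> i) (\<phi> j)"
  by (auto simp: compose_def edge_map_def fun_eq_iff)

lemma sset_hom_simp: "F \<in> sset_hom X Y \<Longrightarrow> x \<in> simp X n \<Longrightarrow> F n x \<in> simp Y n"
  by (auto simp: sset_hom_def PiE_def)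

lemma sset_hom_act:
  "F \<in> sset_hom X Y \<Longrightarrow> \<phi> \<in> delta_hom n k \<Longrightarrow> x \<in> simp X k \<Longrightarrow> F n (act X n k \<phi> x) = act Y n k \<phi> (F k x)"
  by (auto simp: sset_hom_def)

lemma simplicial_set_act:
  "simplicial_set X \<Longrightarrow> \<phi> \<in> delta_hom n k \<Longrightarrow> x \<in> simp X k \<Longrightarrow> act X n k \<phi> x \<in> simp X n"
  unfolding simplicial_set_def by blast

lemma nerve_carr:
  assumes "partial_unital_magma M" "\<sigma> \<in> simp (nerve M) n" "i \<le> j" "j \<le> n"
  shows "\<sigma> (delem i j) \<in> carr M"
  using assms(2-) coherent_carr[OF assms(1), of n "\<lambda>i j. \<sigma> (delem i j)"]
  by (simp add: simp_nerve_iff[OF assms(1)])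

lemma nerve_unt: "partial_unital_magma M \<Longrightarrow> \<sigma> \<in> simp (nerve M) n \<Longrightarrow> \<sigma> DOne = unt M"
  by (auto simp: simp_nerve_iff coherent_def)

lemma nerve_map_delem:
  assumes "\<sigma> \<in> simp (nerve M) n" "i \<le> j" "j \<le> n"
  shows "nerve_map M f n \<sigma> (delem i j) = f (\<sigma> (delem i j))"
  using assms by (simp add: nerve_map_def compose_eq)

lemma nerve_map_ext: "\<sigma> \<in> simp (nerve M) n \<Longrightarrow> nerve_map M f n \<sigma> \<in> extensional (dmag_carr n)"
  by (simp add: nerve_map_def)

lemma nerve_map_simp:
  assumes "partial_unital_magma M" "partial_unital_magma L" "f \<in> magad_hom M L" "\<sigma> \<in> simp (nerve M) n"
  shows "nerve_map M f n \<sigma> \<in> simp (nerve L) n"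
  unfolding simp_nerve_iff[OF assms(2)]
proof (intro conjI allI impI ballI nerve_map_ext assms(4))
  note \<sigma> = assms(4)[unfolded simp_nerve_iff[OF assms(1)]]
  have "coherent L n (\<lambda>i j. f (\<sigma> (delem i j)))"
    using assms(3) \<sigma> by (auto simp: coherent_def magad_hom_def pumag_hom_def)
  then show "coherent L n (\<lambda>i j. nerve_map M f n \<sigma> (delem i j))"
    by (subst coherent_cong) (rule nerve_map_delem[OF assms(4)])
  fix k \<psi> assume k: "0 < k" "\<psi> \<in> delta_hom k n"
  have "chain (\<lambda>i j. nerve_map M f n \<sigma> (delem (\<psi> i) (\<psi> j))) k
      = map f (chain (\<lambda>i j. \<sigma> (delem (\<psi> i) (\<psi> j))) k)"
    unfolding map_chain using k
    by (intro chain_cong nerve_map_delem[OF assms(4)]) (auto intro: delta_hom_mono delta_hom_le)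
  then show "chain (\<lambda>i j. nerve_map M f n \<sigma> (delem (\<psi> i) (\<psi> j))) k \<in> datum L k"
    using \<sigma> k assms(3) by (auto simp: magad_hom_def)
qed

lemma nerve_map_hom:
  assumes "partial_unital_magma M" "partial_unital_magma L" "f \<in> magad_hom M L"
  shows "nerve_map M f \<in> sset_hom (nerve M) (nerve L)"
  unfolding sset_hom_def
proof (intro CollectI conjI allI ballI PiE_I)
  fix n \<sigma> assume "\<sigma> \<in> simp (nerve M) n"
  then show "nerve_map M f n \<sigma> \<in> simp (nerve L) n" by (rule nerve_map_simp[OF assms])
next
  fix n \<sigma> assume "\<sigma> \<notin> simp (nerve M) n"
  then show "nerve_map M f n \<sigma> = undefined" by (simp add: nerve_map_def)
next
  fix n k \<phi> \<sigma> assume h: "\<phi> \<in> delta_hom n k" "\<sigma> \<in> simp (nerve M) k"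
  note s = simplicial_set_act[OF simplicial_set_nerve[OF assms(1)] h]
  show "nerve_map M f n (act (nerve M) n k \<phi> \<sigma>) = act (nerve L) n k \<phi> (nerve_map M f k \<sigma>)"
    using h by (intro ext_delemI[OF nerve_map_ext[OF s] act_nerve_ext])
      (simp add: nerve_map_delem[OF s] nerve_map_delem delta_hom_mono delta_hom_le)
qed

lemma nerve_map_id:
  assumes "partial_unital_magma M"
  shows "nerve_map M (magad_id M) = sset_id (nerve M)"
proof (rule ext, rule ext)
  fix n \<sigma>
  show "nerve_map M (magad_id M) n \<sigma> = sset_id (nerve M) n \<sigma>"
  proof (cases "\<sigma> \<in> simp (nerve M) n")
    case True
    have "nerve_map M (magad_id M) n \<sigma> = \<sigma>"
      using True simp_nerve_iff[OF assms, of \<sigma> n]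
      by (intro ext_delemI[OF nerve_map_ext[OF True]])
        (simp_all add: nerve_map_delem magad_id_def nerve_carr[OF assms])
    then show ?thesis using True by (simp add: sset_id_def)
  qed (simp add: nerve_map_def sset_id_def)
qed

lemma nerve_map_comp:
  assumes "partial_unital_magma M" "partial_unital_magma L" "f \<in> magad_hom M L"
  shows "nerve_map M (magad_comp M g f) = sset_comp (nerve M) (nerve_map L g) (nerve_map M f)"
proof (rule ext, rule ext)
  fix n \<sigma>
  show "nerve_map M (magad_comp M g f) n \<sigma> = sset_comp (nerve M) (nerve_map L g) (nerve_map M f) n \<sigma>"
  proof (cases "\<sigma> \<in> simp (nerve M) n")
    case True
    note L = nerve_map_simp[OF assms True]
    have "nerve_map M (magad_comp M g f) n \<sigma> = nerve_map L g n (nerve_map M f n \<sigma>)"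
      using True
      by (intro ext_delemI[OF nerve_map_ext[OF True] nerve_map_ext[OF L]])
        (simp add: nerve_map_delem nerve_map_delem[OF L] magad_comp_def compose_eq nerve_carr[OF assms(1)])
    then show ?thesis using True by (simp add: sset_comp_def compose_eq)
  qed (simp add: nerve_map_def sset_comp_def compose_def)
qed

section \<open>Faithfulness and fullness\<close>

lemma nerve_map_inj:
  assumes M: "mag_ad M"
  shows "inj_on (nerve_map M) (magad_hom M L)"
proof (rule inj_onI)
  fix f g assume fg: "f \<in> magad_hom M L" "g \<in> magad_hom M L" "nerve_map M f = nerve_map M g"
  \<comment> \<open>The edge with value \<open>m\<close> at \<open>delem 0 1\<close> is sent to
    edges with values \<open>f m\<close> and \<open>g m\<close> there.\<close>
  have "f m = g m" if "m \<in> carr M" for m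
    using nerve_map_delem[OF edge_simplex(1)[OF M that], of 0 1] edge_simplex(2)[OF M that] fg(3)
    by (metis le_refl zero_le_one)
  moreover have "f \<in> extensional (carr M)" "g \<in> extensional (carr M)"
    using fg by (auto simp: magad_hom_def pumag_hom_def PiE_def)
  ultimately show "f = g" by (rule extensionalityI[rotated 2])
qed

text \<open>A simplicial map commutes with restriction to edges, so \<open>F\<close> acts entrywise
  on every simplex by the map \<open>f\<close> it induces on edges. That \<open>f\<close> preserves
  products and data is seen by applying \<open>F\<close> to simplices with given spine, which
  closure of the datum supplies.\<close>

lemma nerve_full:
  assumes M: "mag_ad M" and L: "mag_ad L" and mc: "mult_closed_datum M"
    and F: "F \<in> sset_hom (nerve M) (nerve L)"
  shows "F \<in> nerve_map M ` magad_hom M L"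
proof
  note pM = mag_ad_pum[OF M] and pL = mag_ad_pum[OF L]
  define f where "f = (\<lambda>m\<in>carr M. F 1 (spine_simplex M [m]) (delem 0 1))"
  have F_delem: "F n \<sigma> (delem i j) = f (\<sigma> (delem i j))"
    if \<sigma>: "\<sigma> \<in> simp (nerve M) n" and ij: "i \<le> j" "j \<le> n" for n \<sigma> i j
  proof -
    note \<phi> = edge_map_delta[OF ij]
    note m = nerve_carr[OF pM \<sigma> ij]
    let ?\<tau> = "act (nerve M) 1 n (edge_map i j) \<sigma>"
    \<comment> \<open>Both edges have the same value at \<open>delem 0 1\<close>, which determines
      an edge.\<close>
    have "?\<tau> = spine_simplex M [\<sigma> (delem i j)]"
      using simplicial_set_act[OF simplicial_set_nerve[OF pM] \<phi> \<sigma>] edge_simplex[OF M m] \<phi>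
      by (intro nerve_simplex_eqI[OF pM, of _ 1]) simp_all
    moreover have "F 1 ?\<tau> (delem 0 1) = F n \<sigma> (delem i j)"
      using sset_hom_act[OF F \<phi> \<sigma>] \<phi> by simp
    ultimately show ?thesis using m by (simp add: f_def)
  qed
  have F_nerve: "coherent L n (\<lambda>i j. F n \<sigma> (delem i j))"
    "0 < k \<Longrightarrow> \<psi> \<in> delta_hom k n \<Longrightarrow> chain (\<lambda>i j. F n \<sigma> (delem (\<psi> i) (\<psi> j))) k \<in> datum L k"
    if "\<sigma> \<in> simp (nerve M) n" for n \<sigma> k \<psi>
    using sset_hom_simp[OF F that] by (simp_all add: simp_nerve_iff[OF pL])
  have f_carr: "f m \<in> carr L" if "m \<in> carr M" for m
    using F_delem[OF edge_simplex(1)[OF M that], of 0 1] edge_simplex(2)[OF M that]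
      nerve_carr[OF pL sset_hom_simp[OF F edge_simplex(1)[OF M that]], of 0 1] by simp
  have f_unt: "f (unt M) = unt L"
  proof -
    have u: "unt M \<in> carr M" using pM by (simp add: partial_unital_magma_def)
    note e = edge_simplex(1)[OF M u]
    show ?thesis
      using F_delem[OF e, of 0 0] nerve_unt[OF pM e] nerve_unt[OF pL sset_hom_simp[OF F e]] by simp
  qed
  have f_mult: "pmult L (f x) (f y) = Some (f z)" if xyz: "pmult M x y = Some z" for x y z
  proof -
    have d: "[x, y] \<in> datum M 2" using datum_pair[OF M] xyz by simp
    let ?\<sigma> = "spine_simplex M [x, y]"
    have \<sigma>: "?\<sigma> \<in> simp (nerve M) 2" "?\<sigma> (delem 0 1) = x" "?\<sigma> (delem 1 2) = y"
      using spine_simplex[OF M d] mc by (force simp: numeral_2_eq_2)+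
    \<comment> \<open>Coherence in \<open>M\<close> forces the third side of the triangle to be
      \<open>z\<close>; coherence of the image triangle in \<open>L\<close> is then the
      claim.\<close>
    have "pmult M (?\<sigma> (delem 0 1)) (?\<sigma> (delem 1 2)) = Some (?\<sigma> (delem 0 2))"
      using \<sigma>(1) by (simp add: simp_nerve_iff[OF pM] coherent_def)
    then have z: "?\<sigma> (delem 0 2) = z" using xyz \<sigma> by simp
    have "pmult L (F 2 ?\<sigma> (delem 0 1)) (F 2 ?\<sigma> (delem 1 2)) = Some (F 2 ?\<sigma> (delem 0 2))"
      using F_nerve(1)[OF \<sigma>(1)] by (simp add: coherent_def)
    then show ?thesis using F_delem[OF \<sigma>(1)] \<sigma> z by simp
  qed
  have f_datum: "map f bs \<in> datum L n" if bs: "bs \<in> datum M n" for n bs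
  proof (cases "n = 0")
    case True
    then show ?thesis using bs M by (simp add: mag_ad_def associativity_datum_def)
  next
    case False
    then have n: "0 < n" by simp
    note \<sigma> = spine_simplex[OF M bs n disjI1[OF mc]]
    have i: "(\<lambda>i\<in>{..n}. i) \<in> delta_hom n n" by (rule delta_homI) auto
    \<comment> \<open>The datum condition at the identity of \<open>{..n}\<close> concerns the spine
      of the simplex itself.\<close>
    have "map f bs = chain (\<lambda>i j. F n (spine_simplex M bs) (delem ((\<lambda>i\<in>{..n}. i) i) ((\<lambda>i\<in>{..n}. i) j))) n"
      using datum_length[OF M bs] F_delem[OF \<sigma>(1)] \<sigma>(2) by (intro nth_equalityI) simp_all
    then show ?thesis using F_nerve(2)[OF \<sigma>(1) n i] by simp
  qed
  show f: "f \<in> magad_hom M L"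
    using f_carr f_unt f_mult f_datum by (auto simp: magad_hom_def pumag_hom_def f_def)
  show "F = nerve_map M f"
  proof (rule ext, rule ext)
    fix n \<sigma>
    show "F n \<sigma> = nerve_map M f n \<sigma>"
    proof (cases "\<sigma> \<in> simp (nerve M) n")
      case True
      have "F n \<sigma> \<in> extensional (dmag_carr n)"
        using sset_hom_simp[OF F True] by (simp add: simp_nerve_iff[OF pL])
      then show ?thesis
        using True by (intro ext_delemI[OF _ nerve_map_ext[OF True]]) (simp_all add: F_delem nerve_map_delem)
    next
      case False
      then have "F n \<sigma> = undefined" using F by (auto simp: sset_hom_def PiE_def extensional_def)
      then show ?thesis using False by (simp add: nerve_map_def)
    qed
  qed
qed

section \<open>The essential image\<close>

lemma nerve_spiny:
  assumes "partial_unital_magma M"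
  shows "spiny (nerve M)"
  unfolding spiny_def
proof (intro allI impI inj_onI)
  fix n \<sigma> \<tau>
  assume h: "\<sigma> \<in> simp (nerve M) n" "\<tau> \<in> simp (nerve M) n"
    "map (\<lambda>i. act (nerve M) 1 n (spine_edge i) \<sigma>) [0..<n] = map (\<lambda>i. act (nerve M) 1 n (spine_edge i) \<tau>) [0..<n]"
  show "\<sigma> = \<tau>"
  proof (rule nerve_simplex_eqI[OF assms h(1,2)])
    fix i assume i: "i < n"
    then have "act (nerve M) 1 n (edge_map i (Suc i)) \<sigma> (delem 0 1) = act (nerve M) 1 n (edge_map i (Suc i)) \<tau> (delem 0 1)"
      using h(3) by (simp add: spine_edge_eq)
    then show "\<sigma> (delem i (Suc i)) = \<tau> (delem i (Suc i))"
      using act_nerve_delem[OF edge_map_delta[of i "Suc i" n], of 0 1 M] i by simp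
  qed
qed

text \<open>Existence comes from a vertex of the edge given by the unit, uniqueness from the fact
  that a \<open>0\<close>-simplex has an empty spine.\<close>

lemma nerve_reduced:
  assumes M: "mag_ad M"
  shows "reduced (nerve M)"
proof -
  note pM = mag_ad_pum[OF M]
  have u: "unt M \<in> carr M" using pM by (simp add: partial_unital_magma_def)
  have "(\<lambda>t\<in>{..0}. 0) \<in> delta_hom 0 1" by (rule delta_homI) auto
  from simplicial_set_act[OF simplicial_set_nerve[OF pM] this edge_simplex(1)[OF M u]]
  obtain \<sigma> where "\<sigma> \<in> simp (nerve M) 0" by blast
  moreover have "\<tau> = \<sigma>" if "\<tau> \<in> simp (nerve M) 0" for \<tau>
    using nerve_simplex_eqI[OF pM that \<open>\<sigma> \<in> simp (nerve M) 0\<close>] by simp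
  ultimately show ?thesis unfolding reduced_def by (intro is_singletonI') auto
qed

text \<open>\<open>G\<close> commutes with restriction to the spine and \<open>F\<close> recovers
  \<open>x\<close> from \<open>G n x\<close>, so both properties pass from \<open>Y\<close> to
  \<open>X\<close>.\<close>

lemma sset_isomorphic_spiny_reduced:
  assumes "sset_isomorphic Y X" "simplicial_set X" "spiny Y" "reduced Y"
  shows "spiny X \<and> reduced X"
proof -
  obtain F G where F: "F \<in> sset_hom Y X" and G: "G \<in> sset_hom X Y"
    and FG: "sset_comp X F G = sset_id X"
    using assms(1) by (auto simp: sset_isomorphic_def)
  have FG': "F n (G n x) = x" if "x \<in> simp X n" for n x
    using fun_cong[OF fun_cong[OF FG], of n x] that by (simp add: sset_comp_def sset_id_def compose_eq)
  have "spiny X"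
    unfolding spiny_def
  proof (intro allI impI inj_onI)
    fix n :: nat and x y
    assume n: "2 \<le> n" and x: "x \<in> simp X n" and y: "y \<in> simp X n"
      and eq: "map (\<lambda>i. act X 1 n (spine_edge i) x) [0..<n] = map (\<lambda>i. act X 1 n (spine_edge i) y) [0..<n]"
    have "act Y 1 n (spine_edge i) (G n x) = act Y 1 n (spine_edge i) (G n y)" if "i < n" for i
    proof -
      have d: "spine_edge i \<in> delta_hom 1 n" unfolding spine_edge_eq using that by (intro edge_map_delta) simp_all
      have "act X 1 n (spine_edge i) x = act X 1 n (spine_edge i) y" using eq that by simp
      then show ?thesis using sset_hom_act[OF G d] x y by metis
    qed
    then have m: "map (\<lambda>i. act Y 1 n (spine_edge i) (G n x)) [0..<n] = map (\<lambda>i. act Y 1 n (spine_edge i) (G n y)) [0..<n]"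
      by simp
    have "inj_on (\<lambda>x. map (\<lambda>i. act Y 1 n (spine_edge i) x) [0..<n]) (simp Y n)"
      using assms(3) n by (simp add: spiny_def)
    then have "G n x = G n y"
      using m sset_hom_simp[OF G x] sset_hom_simp[OF G y] by (rule inj_onD)
    then show "x = y" using FG' x y by metis
  qed
  moreover have "reduced X"
  proof -
    obtain \<sigma> where \<sigma>: "simp Y 0 = {\<sigma>}" using assms(4) by (auto simp: reduced_def is_singleton_def)
    have "x = F 0 \<sigma>" if "x \<in> simp X 0" for x
      using sset_hom_simp[OF G that] FG'[OF that] \<sigma> by simp
    moreover have "F 0 \<sigma> \<in> simp X 0" by (rule sset_hom_simp[OF F]) (simp add: \<sigma>)
    ultimately show ?thesis unfolding reduced_def by (intro is_singletonI') auto
  qed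
  ultimately show ?thesis ..
qed

text \<open>Naturality of the degreewise inverse follows by applying \<open>G\<close> to the
  naturality of \<open>F\<close> at \<open>G k y\<close>. Restricting \<open>G n\<close> to
  \<open>simp Y n\<close> makes it extensional, as \<open>sset_hom\<close> requires.\<close>

lemma sset_isomorphicI:
  assumes X: "simplicial_set X" and F: "F \<in> sset_hom X Y"
    and bij: "\<And>n. bij_betw (F n) (simp X n) (simp Y n)"
  shows "sset_isomorphic Y X"
proof -
  define G where "G n = restrict (inv_into (simp X n) (F n)) (simp Y n)" for n
  have G_simp: "G n y \<in> simp X n" and FG: "F n (G n y) = y" if "y \<in> simp Y n" for n y
    using that bij[of n] by (auto simp: G_def bij_betw_def inv_into_into f_inv_into_f)
  have GF: "G n (F n x) = x" if "x \<in> simp X n" for n x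
    using that bij[of n] sset_hom_simp[OF F that] by (simp add: G_def bij_betw_def)
  have "G n (act Y n k \<phi> y) = act X n k \<phi> (G k y)"
    if "\<phi> \<in> delta_hom n k" "y \<in> simp Y k" for n k \<phi> y
    using sset_hom_act[OF F that(1) G_simp[OF that(2)]] FG[OF that(2)]
      GF[OF simplicial_set_act[OF X that(1) G_simp[OF that(2)]]] by simp
  then have "G \<in> sset_hom Y X" using G_simp by (auto simp: sset_hom_def G_def)
  moreover have "sset_comp Y F G = sset_id Y" "sset_comp X G F = sset_id X"
    using FG GF by (auto simp: sset_comp_def sset_id_def compose_def fun_eq_iff)
  ultimately show ?thesis using F by (auto simp: sset_isomorphic_def)
qed

section \<open>The magma of edges of a spiny reduced simplicial set\<close>

definition edge :: "'b sset \<Rightarrow> nat \<Rightarrow> 'b \<Rightarrow> nat \<Rightarrow> nat \<Rightarrow> 'b" where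
  "edge X n w i j = act X 1 n (edge_map i j) w"

text \<open>The product is the long edge of a triangle with the given short edges, and the unit is
  the degenerate edge at the only vertex. For spiny \<open>X\<close> the triangle chosen by
  \<open>SOME\<close> is unique.\<close>

definition edge_magma :: "'b sset \<Rightarrow> 'b magad" where
  "edge_magma X = \<lparr>carr = simp X 1, unt = edge X 0 (the_elem (simp X 0)) 0 0,
     pmult = (\<lambda>x y. if \<exists>w\<in>simp X 2. edge X 2 w 0 1 = x \<and> edge X 2 w 1 2 = y
       then Some (edge X 2 (SOME w. w \<in> simp X 2 \<and> edge X 2 w 0 1 = x \<and> edge X 2 w 1 2 = y) 0 2)
       else None),
     datum = (\<lambda>n. if n = 0 then {} else (\<lambda>w. chain (edge X n w) n) ` simp X n)\<rparr>"

context
  fixes X :: "'b sset"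
  assumes X: "simplicial_set X" and spiny: "spiny X" and reduced: "reduced X"
begin

lemma edge_simp: "w \<in> simp X n \<Longrightarrow> i \<le> j \<Longrightarrow> j \<le> n \<Longrightarrow> edge X n w i j \<in> simp X 1"
  unfolding edge_def by (rule simplicial_set_act[OF X edge_map_delta])

lemma edge_act:
  assumes "\<phi> \<in> delta_hom n k" "w \<in> simp X k" "i \<le> j" "j \<le> n"
  shows "edge X n (act X n k \<phi> w) i j = edge X k w (\<phi> i) (\<phi> j)"
  using X edge_map_delta[OF assms(3,4)] assms(1,2)
  unfolding simplicial_set_def edge_def compose_edge_map[symmetric] by metis

lemma edge_1: "w \<in> simp X 1 \<Longrightarrow> edge X 1 w 0 1 = w"
  using X unfolding simplicial_set_def edge_def edge_map_id by metis

lemma simp_0_eq: "v \<in> simp X 0 \<Longrightarrow> w \<in> simp X 0 \<Longrightarrow> v = w"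
  using reduced by (auto simp: reduced_def is_singleton_def)

text \<open>Extends spininess to the remaining degrees: \<open>n = 0\<close> is reducedness, and an
  edge is its own spine.\<close>

lemma spine_inj:
  assumes "v \<in> simp X n" "w \<in> simp X n" "chain (edge X n v) n = chain (edge X n w) n"
  shows "v = w"
proof -
  consider "n = 0" | "n = 1" | "2 \<le> n" by linarith
  then show ?thesis
  proof cases
    case 1
    then show ?thesis using assms(1,2) simp_0_eq by simp
  next
    case 2
    then show ?thesis using assms edge_1[of v] edge_1[of w] by (simp add: chain_def)
  next
    case 3
    then have "inj_on (\<lambda>x. map (\<lambda>i. act X 1 n (spine_edge i) x) [0..<n]) (simp X n)"
      using spiny by (simp add: spiny_def)
    then show ?thesis
      by (rule inj_onD) (use assms in \<open>simp_all add: chain_def edge_def spine_edge_eq\<close>)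
  qed
qed

text \<open>Spininess makes the triangle over \<open>x\<close> and \<open>y\<close> unique, which
  removes the choice from the product.\<close>

lemma pmult_edge_magma:
  "pmult (edge_magma X) x y = Some z \<longleftrightarrow>
     (\<exists>w\<in>simp X 2. edge X 2 w 0 1 = x \<and> edge X 2 w 1 2 = y \<and> edge X 2 w 0 2 = z)"
proof (cases "\<exists>w\<in>simp X 2. edge X 2 w 0 1 = x \<and> edge X 2 w 1 2 = y")
  case True
  then obtain w where w: "w \<in> simp X 2" "edge X 2 w 0 1 = x" "edge X 2 w 1 2 = y" by blast
  have u: "v = w" if "v \<in> simp X 2" "edge X 2 v 0 1 = x" "edge X 2 v 1 2 = y" for v
    using spine_inj[OF that(1) w(1)] that w by (simp add: chain_def numeral_2_eq_2)
  then have "(SOME w. w \<in> simp X 2 \<and> edge X 2 w 0 1 = x \<and> edge X 2 w 1 2 = y) = w"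
    using w by (intro some_equality) blast+
  then have "pmult (edge_magma X) x y = Some (edge X 2 w 0 2)"
    using True by (simp add: edge_magma_def)
  moreover have "(\<exists>v\<in>simp X 2. edge X 2 v 0 1 = x \<and> edge X 2 v 1 2 = y \<and> edge X 2 v 0 2 = z)
      \<longleftrightarrow> edge X 2 w 0 2 = z"
    using u w by blast
  ultimately show ?thesis by simp
qed (auto simp: edge_magma_def)

text \<open>The degenerate edges at all vertices of \<open>w\<close> agree because \<open>X\<close>
  has only one vertex; the products are witnessed by the triangles of \<open>w\<close> on the
  vertices \<open>i\<close>, \<open>j\<close>, \<open>k\<close>.\<close>

lemma coherent_edge:
  assumes w: "w \<in> simp X n"
  shows "coherent (edge_magma X) n (edge X n w)"
  unfolding coherent_def
proof (intro conjI allI impI)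
  fix i assume "i \<le> n"
  then have d: "(\<lambda>t\<in>{..0}. i) \<in> delta_hom 0 n" by (intro delta_homI) auto
  have "simp X 0 = {act X 0 n (\<lambda>t\<in>{..0}. i) w}"
    using simplicial_set_act[OF X d w] simp_0_eq by blast
  then show "edge X n w i i = unt (edge_magma X)"
    using edge_act[OF d w, of 0 0] by (simp add: edge_magma_def)
next
  fix i j k assume ijk: "i \<le> j" "j \<le> k" "k \<le> n"
  let ?t = "\<lambda>t\<in>{..2}. if t = 0 then i else if t = 1 then j else k"
  have d: "?t \<in> delta_hom 2 n" using ijk by (intro delta_homI) auto
  show "pmult (edge_magma X) (edge X n w i j) (edge X n w j k) = Some (edge X n w i k)"
    unfolding pmult_edge_magma
    using simplicial_set_act[OF X d w] edge_act[OF d w, of 0 1] edge_act[OF d w, of 1 2] edge_act[OF d w, of 0 2]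
    by (intro bexI[of _ "act X 2 n ?t w"]) simp_all
qed

lemma edge_magma_pum: "partial_unital_magma (edge_magma X)"
proof -
  obtain v where v: "v \<in> simp X 0" using reduced by (auto simp: reduced_def is_singleton_def)
  then have "unt (edge_magma X) \<in> simp X 1"
    using edge_simp[OF v, of 0 0] coherent_edge[OF v] by (simp add: coherent_def)
  moreover have "x \<in> simp X 1 \<and> y \<in> simp X 1 \<and> z \<in> simp X 1" if "pmult (edge_magma X) x y = Some z" for x y z
    using that unfolding pmult_edge_magma by (auto intro!: edge_simp[unfolded One_nat_def])
  moreover have "pmult (edge_magma X) m (unt (edge_magma X)) = Some m
      \<and> pmult (edge_magma X) (unt (edge_magma X)) m = Some m" if m: "m \<in> simp X 1" for m
  proof -
    \<comment> \<open>The unit laws are coherence equations of \<open>m\<close> itself, seen as a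
      \<open>1\<close>-simplex.\<close>
    have "pmult (edge_magma X) (edge X 1 m 0 1) (edge X 1 m 1 1) = Some (edge X 1 m 0 1)"
      "pmult (edge_magma X) (edge X 1 m 0 0) (edge X 1 m 0 1) = Some (edge X 1 m 0 1)"
      "edge X 1 m 1 1 = unt (edge_magma X)" "edge X 1 m 0 0 = unt (edge_magma X)"
      by (intro coherentD[OF coherent_edge[OF m]]; simp)+
    then show ?thesis by (simp only: edge_1[OF m])
  qed
  ultimately show ?thesis
    by (simp add: partial_unital_magma_def edge_magma_def[of X, THEN arg_cong[where f = carr]])
qed

text \<open>Such a tuple is the spine of the simplex obtained by pulling \<open>w\<close> back along
  \<open>\<phi>\<close>. Closure properties of the datum thus reduce to a choice of
  \<open>\<phi>\<close>.\<close>

lemma edge_magma_datumI: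
  assumes "w \<in> simp X n" "0 < k" "\<phi> k \<le> n" "\<And>i j. i \<le> j \<Longrightarrow> j \<le> k \<Longrightarrow> \<phi> i \<le> \<phi> j"
    and "length bs = k" "\<And>i. i < k \<Longrightarrow> bs ! i = edge X n w (\<phi> i) (\<phi> (Suc i))"
  shows "bs \<in> datum (edge_magma X) k"
proof -
  let ?\<phi> = "\<lambda>i\<in>{..k}. \<phi> i"
  have d: "?\<phi> \<in> delta_hom k n" using assms by (intro delta_homI) auto
  have "bs = chain (edge X k (act X k n ?\<phi> w)) k"
    using assms by (intro nth_equalityI) (simp_all add: edge_act[OF d assms(1)])
  then show ?thesis using simplicial_set_act[OF X d assms(1)] assms(2) by (auto simp: edge_magma_def)
qed

lemma edge_magma_datumE:
  assumes "bs \<in> datum (edge_magma X) n"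
  obtains w where "w \<in> simp X n" "bs = chain (edge X n w) n" "0 < n"
  using assms by (auto simp: edge_magma_def split: if_splits)

lemma edge_magma_mag_ad: "mag_ad (edge_magma X)"
proof -
  let ?M = "edge_magma X"
  have "datum ?M 0 = {}" by (simp add: edge_magma_def)
  moreover have "datum ?M 1 = {[m] | m. m \<in> carr ?M}"
    using edge_1 by (auto simp: edge_magma_def chain_def image_iff)
  moreover have "datum ?M n \<subseteq> fully_assoc_tuples ?M n" for n
    using coherent_fully_associable[OF edge_magma_pum coherent_edge]
    by (auto simp: fully_assoc_tuples_def elim!: edge_magma_datumE)
  moreover have "datum ?M 2 = {[x, y] | x y. pmult ?M x y \<noteq> None}"
  proof -
    have "chain e 2 = [e 0 1, e 1 2]" for e :: "nat \<Rightarrow> nat \<Rightarrow> 'b"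
      by (simp add: chain_def numeral_2_eq_2)
    then have "datum ?M 2 = {[x, y] | x y. \<exists>w\<in>simp X 2. edge X 2 w 0 1 = x \<and> edge X 2 w 1 2 = y}"
      by (auto simp: edge_magma_def)
    then show ?thesis by (auto simp: pmult_edge_magma not_None_eq)
  qed
  moreover have "take i bs \<in> datum ?M i \<and> drop i bs \<in> datum ?M (n - i)"
    if bs: "bs \<in> datum ?M n" and i: "1 \<le> i" "i < n" for n bs i
  proof -
    obtain w where w: "w \<in> simp X n" "bs = chain (edge X n w) n" using bs by (elim edge_magma_datumE)
    \<comment> \<open>The two maps include the vertices \<open>0\<close> to \<open>i\<close> and the
      vertices \<open>i\<close> to \<open>n\<close>.\<close>
    have "take i bs \<in> datum ?M i"
      by (rule edge_magma_datumI[OF w(1), of _ "\<lambda>t. t"]) (use w i in simp_all)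
    moreover have "drop i bs \<in> datum ?M (n - i)"
      by (rule edge_magma_datumI[OF w(1), of _ "\<lambda>t. i + t"]) (use w i in simp_all)
    ultimately show ?thesis ..
  qed
  moreover have "take i bs @ [unt ?M] @ drop i bs \<in> datum ?M (n + 1)"
    if bs: "bs \<in> datum ?M n" and i: "i \<le> n" for n bs i
  proof -
    obtain w where w: "w \<in> simp X n" "bs = chain (edge X n w) n" using bs by (elim edge_magma_datumE)
    have u: "edge X n w i i = unt ?M" using coherent_edge[OF w(1)] i by (simp add: coherent_def)
    \<comment> \<open>The map is the degeneracy hitting the vertex \<open>i\<close> twice; the extra
      entry it creates is \<open>edge X n w i i\<close>, the unit.\<close>
    show ?thesis
      by (rule edge_magma_datumI[OF w(1), of _ "\<lambda>t. if t \<le> i then t else t - 1"])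
        (use w i u in \<open>auto simp: nth_append nth_Cons' min_def not_less dest: le_antisym\<close>)
  qed
  ultimately show ?thesis
    unfolding mag_ad_def associativity_datum_def using edge_magma_pum by simp
qed

text \<open>Multiplying two neighbouring entries removes the vertex between them: the new tuple is
  the spine of the inner face omitting the vertex \<open>Suc (length bs)\<close>.\<close>

lemma edge_magma_mult_closed: "mult_closed_datum (edge_magma X)"
  unfolding mult_closed_datum_def
proof (intro allI impI)
  fix bs cs :: "'b list" and x y z
  let ?n = "length bs + 2 + length cs" and ?p = "length bs"
  assume d: "bs @ [x, y] @ cs \<in> datum (edge_magma X) ?n" and z: "pmult (edge_magma X) x y = Some z"
  obtain w where w: "w \<in> simp X ?n" and eq: "bs @ [x, y] @ cs = chain (edge X ?n w) ?n"
    using d by (elim edge_magma_datumE)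
  have nth: "(bs @ [x, y] @ cs) ! i = edge X ?n w i (Suc i)" if "i < ?n" for i
    unfolding eq using that by simp
  have "x = edge X ?n w ?p (Suc ?p)" "y = edge X ?n w (Suc ?p) (Suc (Suc ?p))"
    using nth[of ?p] nth[of "Suc ?p"] by (simp_all add: nth_append)
  then have z': "z = edge X ?n w ?p (Suc (Suc ?p))"
    using z coherent_edge[OF w] unfolding coherent_def by simp
  show "bs @ [z] @ cs \<in> datum (edge_magma X) (length bs + 1 + length cs)"
  proof (rule edge_magma_datumI[OF w, of _ "\<lambda>t. if t \<le> ?p then t else Suc t"])
    fix i assume i: "i < length bs + 1 + length cs"
    consider "i < ?p" | "i = ?p" | "?p < i" by linarith
    then show "(bs @ [z] @ cs) ! i = edge X ?n w (if i \<le> ?p then i else Suc i) (if Suc i \<le> ?p then Suc i else Suc (Suc i))"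
    proof cases
      case 1
      then show ?thesis using nth[of i] i by (simp add: nth_append)
    next
      case 2
      then show ?thesis using z' by simp
    next
      case 3
      then obtain q where "i = Suc (?p + q)" using less_imp_Suc_add by blast
      then show ?thesis using nth[of "Suc i"] i by (simp add: nth_append)
    qed
  qed auto
qed

section \<open>The comparison map to the nerve of the edge magma\<close>

definition edge_nerve :: "nat \<Rightarrow> 'b \<Rightarrow> delem \<Rightarrow> 'b" where
  "edge_nerve n = (\<lambda>w\<in>simp X n. simplex_of n (edge X n w))"

lemma edge_nerve_delem: "w \<in> simp X n \<Longrightarrow> i \<le> j \<Longrightarrow> j \<le> n \<Longrightarrow> edge_nerve n w (delem i j) = edge X n w i j"
  by (simp add: edge_nerve_def simplex_of_delem[OF coherent_edge])

lemma edge_nerve_simp: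
  assumes "w \<in> simp X n"
  shows "edge_nerve n w \<in> simp (nerve (edge_magma X)) n"
proof -
  have "chain (\<lambda>i j. edge X n w (\<psi> i) (\<psi> j)) k \<in> datum (edge_magma X) k"
    if "0 < k" "\<psi> \<in> delta_hom k n" for k \<psi>
    by (rule edge_magma_datumI[OF assms, of _ \<psi>]) (use that in \<open>auto intro: delta_hom_mono delta_hom_le\<close>)
  then show ?thesis
    using assms simplex_of_in_nerve[OF edge_magma_pum coherent_edge] by (simp add: edge_nerve_def)
qed

lemma edge_nerve_hom: "edge_nerve \<in> sset_hom X (nerve (edge_magma X))"
proof -
  have "edge_nerve n (act X n k \<phi> w) = act (nerve (edge_magma X)) n k \<phi> (edge_nerve k w)"
    if h: "\<phi> \<in> delta_hom n k" "w \<in> simp X k" for n k \<phi> w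
  proof (rule ext_delemI[OF _ act_nerve_ext])
    note s = simplicial_set_act[OF X h]
    show "edge_nerve n (act X n k \<phi> w) \<in> extensional (dmag_carr n)"
      using s by (simp add: edge_nerve_def simplex_of_ext)
    fix i j assume ij: "i \<le> j" "j \<le> n"
    then show "edge_nerve n (act X n k \<phi> w) (delem i j)
        = act (nerve (edge_magma X)) n k \<phi> (edge_nerve k w) (delem i j)"
      using h by (simp add: edge_nerve_delem s edge_act delta_hom_mono delta_hom_le)
  qed
  then show ?thesis using edge_nerve_simp by (auto simp: sset_hom_def edge_nerve_def)
qed

text \<open>Injectivity is determination by the spine in \<open>X\<close>. For surjectivity,
  membership in the datum of \<open>edge_magma X\<close> makes the spine of \<open>\<sigma>\<close>
  the spine of some \<open>w\<close> in \<open>X\<close>, and simplices of the nerve are determined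
  by their spines.\<close>

lemma edge_nerve_bij: "bij_betw (edge_nerve n) (simp X n) (simp (nerve (edge_magma X)) n)"
proof (rule bij_betw_imageI)
  show "inj_on (edge_nerve n) (simp X n)"
  proof (rule inj_onI)
    fix v w assume vw: "v \<in> simp X n" "w \<in> simp X n" "edge_nerve n v = edge_nerve n w"
    have "chain (edge X n v) n = chain (edge X n w) n"
      using vw edge_nerve_delem[OF vw(1)] edge_nerve_delem[OF vw(2)] by (intro chain_cong) (metis Suc_leI le_SucI le_refl)
    then show "v = w" by (rule spine_inj[OF vw(1,2)])
  qed
  show "edge_nerve n ` simp X n = simp (nerve (edge_magma X)) n"
  proof (intro equalityI subsetI)
    fix \<sigma> assume \<sigma>: "\<sigma> \<in> simp (nerve (edge_magma X)) n"
    obtain w where w: "w \<in> simp X n" "chain (edge X n w) n = chain (\<lambda>i j. \<sigma> (delem i j)) n"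
    \<comment> \<open>The datum is empty in degree \<open>0\<close>, so there the unique vertex of
      \<open>X\<close> is taken.\<close>
    proof (cases "n = 0")
      case True
      then show ?thesis using that reduced by (auto simp: reduced_def is_singleton_def chain_def)
    next
      case False
      have "(\<lambda>i\<in>{..n}. i) \<in> delta_hom n n" by (rule delta_homI) auto
      with False \<sigma> have "chain (\<lambda>i j. \<sigma> (delem ((\<lambda>i\<in>{..n}. i) i) ((\<lambda>i\<in>{..n}. i) j))) n \<in> datum (edge_magma X) n"
        unfolding simp_nerve_iff[OF edge_magma_pum] by blast
      moreover have "chain (\<lambda>i j. \<sigma> (delem ((\<lambda>i\<in>{..n}. i) i) ((\<lambda>i\<in>{..n}. i) j))) n = chain (\<lambda>i j. \<sigma> (delem i j)) n"
        by (rule chain_cong) simp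
      ultimately show ?thesis using that by (auto elim!: edge_magma_datumE)
    qed
    have "\<sigma> = edge_nerve n w"
    proof (rule nerve_simplex_eqI[OF edge_magma_pum \<sigma> edge_nerve_simp[OF w(1)]])
      fix i assume i: "i < n"
      then have "edge X n w i (Suc i) = \<sigma> (delem i (Suc i))"
        using arg_cong[OF w(2), of "\<lambda>l. l ! i"] by simp
      then show "\<sigma> (delem i (Suc i)) = edge_nerve n w (delem i (Suc i))"
        using i by (simp add: edge_nerve_delem[OF w(1)])
    qed
    then show "\<sigma> \<in> edge_nerve n ` simp X n" using w(1) by blast
  qed (auto intro: edge_nerve_simp)
qed

lemma nerve_edge_magma: "sset_isomorphic (nerve (edge_magma X)) X"
  by (rule sset_isomorphicI[OF X edge_nerve_hom edge_nerve_bij])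

end

text \<open>Fullness is stated for sources with a datum closed under multiplying neighbours, in view
  of the counterexample given with \<open>mult_closed_datum\<close>. The object realising a spiny
  reduced \<open>X\<close> is closed as well, so passing to closed objects keeps the essential
  image.\<close>

theorem proposition4p7:
  shows
    "((\<forall>M :: 'a magad. mag_ad M \<longrightarrow> simplicial_set (nerve M)) \<and>
      (\<forall>(M :: 'a magad) (L :: 'b magad). mag_ad M \<longrightarrow> mag_ad L \<longrightarrow>
         (\<forall>f\<in>magad_hom M L. nerve_map M f \<in> sset_hom (nerve M) (nerve L))) \<and>
      (\<forall>M :: 'a magad. mag_ad M \<longrightarrow> nerve_map M (magad_id M) = sset_id (nerve M)) \<and>
      (\<forall>(M :: 'a magad) (L :: 'b magad) (K :: 'c magad).
         mag_ad M \<longrightarrow> mag_ad L \<longrightarrow> mag_ad K \<longrightarrow>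
         (\<forall>f\<in>magad_hom M L. \<forall>g\<in>magad_hom L K.
            nerve_map M (magad_comp M g f) = sset_comp (nerve M) (nerve_map L g) (nerve_map M f)))) \<and>
     (\<forall>(M :: 'a magad) (L :: 'b magad). mag_ad M \<longrightarrow> mag_ad L \<longrightarrow>
        inj_on (nerve_map M) (magad_hom M L)) \<and>
     (\<forall>(M :: 'a magad) (L :: 'b magad). mag_ad M \<longrightarrow> mag_ad L \<longrightarrow> mult_closed_datum M \<longrightarrow>
        nerve_map M ` magad_hom M L = sset_hom (nerve M) (nerve L)) \<and>
     (\<forall>X :: 'd sset. simplicial_set X \<longrightarrow>
        (\<forall>M :: 'a magad. mag_ad M \<longrightarrow> sset_isomorphic (nerve M) X \<longrightarrow> spiny X \<and> reduced X) \<and>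
        (spiny X \<and> reduced X \<longrightarrow>
           (\<exists>M :: 'd magad. mag_ad M \<and> mult_closed_datum M \<and> sset_isomorphic (nerve M) X)))"
proof (intro conjI allI impI ballI)
  fix M :: "'a magad" and L :: "'b magad"
  assume h: "mag_ad M" "mag_ad L" "mult_closed_datum M"
  show "nerve_map M ` magad_hom M L = sset_hom (nerve M) (nerve L)"
    using nerve_full[OF h] nerve_map_hom[OF mag_ad_pum[OF h(1)] mag_ad_pum[OF h(2)]] by blast
next
  fix X :: "'d sset" and M :: "'a magad"
  assume h: "simplicial_set X" "mag_ad M" "sset_isomorphic (nerve M) X"
  note sr = sset_isomorphic_spiny_reduced[OF h(3,1) nerve_spiny[OF mag_ad_pum[OF h(2)]] nerve_reduced[OF h(2)]]
  show "spiny X" "reduced X" using sr by blast+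
next
  fix X :: "'d sset"
  assume "simplicial_set X" "spiny X \<and> reduced X"
  then show "\<exists>M :: 'd magad. mag_ad M \<and> mult_closed_datum M \<and> sset_isomorphic (nerve M) X"
    using edge_magma_mag_ad edge_magma_mult_closed nerve_edge_magma by blast
qed (blast intro: simplicial_set_nerve nerve_map_hom nerve_map_id nerve_map_comp nerve_map_inj mag_ad_pum)+

end
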